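(* Let $N\ge5$, and let $P_N$ be a convex simplicial 3-polytope with $N$ vertices lying on $\mathbb{S}^2$, with $o\in\operatorname{int}(P_N)$. Suppose that $P_N$ has a trivalent vertex $v_0$, incident with the three triangular facets $F_1,F_2,F_3$. Let $$\alpha:=\sum_{i=1}^3\operatorname{area}(R(F_i))$$ be the total solid angle of the star of $v_0$. Then necessarily $0<\alpha<4\pi$, and $$\operatorname{vol}(P_N)\le\frac{\sqrt3}{4}\left[1-\frac13\tan^2\left(\frac{2\pi-\alpha}{6}\right)\right]+\frac{2N-7}{4}\tan\left(\frac{(4N-18)\pi+\alpha}{12N-42}\right)\left[1-\frac13\tan^2\left(\frac{(4N-18)\pi+\alpha}{12N-42}\right)\right].$$
   Context: $\mathbb{S}^2$ is the unit sphere in $\mathbb{R}^3$ and $o$ is the origin. $R(x)=x/\|x\|$ is the radial projection onto $\mathbb{S}^2$, $R(F)$ is the image of a facet $F$, and $\operatorname{area}$ is spherical surface area. $\operatorname{vol}$ is 3-dimensional volume. A trivalent vertex is a vertex of degree 3. The star of a vertex is the union of all facets containing it. *)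

theory Defs
  imports "HOL-Analysis.Analysis"
begin

definition vertices :: "'a::euclidean_space set \<Rightarrow> 'a set" where
  "vertices P = {v. v extreme_point_of P}"

definition simplicial_3_polytope :: "'a::euclidean_space set \<Rightarrow> bool" where
  "simplicial_3_polytope P \<longleftrightarrow>
     polytope P \<and> aff_dim P = 3 \<and> (\<forall>F. F facet_of P \<longrightarrow> 2 simplex F)"

definition vertex_degree :: "'a::euclidean_space set \<Rightarrow> 'a \<Rightarrow> nat" where
  "vertex_degree P v = card {e. e edge_of P \<and> v \<in> e}"

definition facets_at :: "'a::euclidean_space set \<Rightarrow> 'a \<Rightarrow> 'a set set" where
  "facets_at P v = {F. F facet_of P \<and> v \<in> F}"

definition radial_projection :: "'a::real_normed_vector \<Rightarrow> 'a" where
  "radial_projection x = x /\<^sub>R norm x"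

text \<open>Surface measure on the unit sphere of three-space, normalised in the usual way through
  polar coordinates: the cone from the origin over a subset of the unit sphere of
  surface area a has volume a / 3 (the integral of a * r^2 over 0 < r \<le> 1).\<close>

definition spherical_area :: "(real ^ 3) set \<Rightarrow> real" where
  "spherical_area A = 3 * measure lebesgue {t *\<^sub>R x | t x. 0 < t \<and> t \<le> 1 \<and> x \<in> A}"

lemma spherical_area_sphere: "spherical_area (sphere 0 1) = 4 * pi"
proof -
  have eq: "{t *\<^sub>R x | t x. 0 < t \<and> t \<le> 1 \<and> x \<in> sphere (0::real^3) 1} = cball 0 1 - {0}"
    (is "?C = _")
  proof
    show "?C \<subseteq> cball 0 1 - {0}"
      by auto
    show "cball 0 1 - {0} \<subseteq> ?C"
    proof
      fix y :: "real^3" assume "y \<in> cball 0 1 - {0}"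
      then have "y = norm y *\<^sub>R (y /\<^sub>R norm y) \<and> 0 < norm y \<and> norm y \<le> 1
          \<and> y /\<^sub>R norm y \<in> sphere 0 1"
        by auto
      then show "y \<in> ?C" by blast
    qed
  qed
  have "measure lebesgue (cball (0::real^3) 1 - {0}) = measure lebesgue (cball (0::real^3) 1)"
    by (rule measure_Diff_null_set) auto
  also have "\<dots> = 4 / 3 * pi"
    by (simp add: content_cball unit_ball_vol_3)
  finally show ?thesis
    unfolding spherical_area_def eq by simp
qed

end

theory Submission
  imports Defs
begin

text \<open>
  The radial projections of the facets tile the sphere, so \<open>vol P\<close> is the sum of the volumes of
  the pyramids from \<open>o\<close> over the facets, and the spherical areas add up to \<open>4 \<pi>\<close>.  Girard's theorem
  summed over all facets gives the number \<open>2 N - 4\<close> of facets.  For unit vectors with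
  \<open>D = det (a, b, c) > 0\<close> and \<open>C = 1 + a \<bullet> b + b \<bullet> c + c \<bullet> a\<close>, half the area of the
  triangle is the argument of \<open>C + i D\<close>.  Among triangles of given area the regular one has the
  largest \<open>D\<close>, and the resulting bound is concave in the area, so Jensen's inequality settles the
  \<open>2 N - 7\<close> facets outside the star of \<open>v\<^sub>0\<close>.  For a facet at \<open>v\<^sub>0\<close> with angle \<open>\<phi>\<close> there
  and given area, \<open>D\<close> is largest if the triangle is isosceles; this bound is jointly concave in
  \<open>\<phi>\<close> and the area, and the three angles at \<open>v\<^sub>0\<close> add up to \<open>2 \<pi>\<close>, so Jensen's inequality
  applies again.
\<close>

subsection \<open>Volume of a dihedral wedge\<close>

text \<open>No surface integral occurs: an area is three times the volume of a cone in the unit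
  ball, and an angle is 3/2 times the volume of a wedge there. Additivity and rotation invariance
  identify this volume with the Euclidean angle between two planes. The total area
  \<open>4 \<pi>\<close> and the angle sum \<open>2 \<pi>\<close> at a vertex then both say that
  cones, or wedges, tile space. The bound by area alone ignores the constraint on the angles at
  \<open>v\<^sub>0\<close>; the extra variable \<open>\<phi>\<close> records it, at the price of
  concavity in two variables. With \<open>e\<close> half the area, the coordinates
  \<open>\<psi> = \<phi> / 2\<close> and \<open>d = e - \<psi>\<close> split the bound into products
  of functions of one variable. Over the star they add up to \<open>\<pi>\<close> and
  \<open>\<alpha> / 2 - \<pi>\<close>, which gives, up to sign, the argument
  \<open>(2 \<pi> - \<alpha>) / 6\<close>. The other argument is the mean of
  \<open>(\<pi> - e) / 3\<close> over the remaining facets, whose \<open>e\<close> add up to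
  \<open>2 \<pi> - \<alpha> / 2\<close>.\<close>

definition cone_measure :: "'a::euclidean_space set \<Rightarrow> real" where
  "cone_measure S = measure lebesgue (S \<inter> cball 0 1)"

lemma cone_lmeasurable: "S \<in> sets lebesgue \<Longrightarrow> S \<inter> cball (0::'a::euclidean_space) 1 \<in> lmeasurable"
  by (metis fmeasurable_Int_fmeasurable inf_commute lmeasurable_cball)

lemma cone_measure_nonneg: "0 \<le> cone_measure S"
  by (simp add: cone_measure_def)

lemma cone_measure_Un:
  assumes "S \<in> sets lebesgue" "T \<in> sets lebesgue" "negligible (S \<inter> T)"
  shows "cone_measure (S \<union> T) = cone_measure S + cone_measure T"
proof -
  have "negligible ((S \<inter> cball 0 1) \<inter> (T \<inter> cball 0 1))"
    by (rule negligible_subset[OF assms(3)]) auto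
  then have "measure lebesgue ((S \<inter> cball 0 1) \<union> (T \<inter> cball 0 1)) = cone_measure S + cone_measure T"
    unfolding cone_measure_def
    using assms by (simp add: measure_Un3 cone_lmeasurable negligible_imp_measure0)
  then show ?thesis
    by (simp add: cone_measure_def Int_Un_distrib2)
qed

lemma cone_measure_UN:
  assumes "finite I" "\<And>i. i \<in> I \<Longrightarrow> S i \<in> sets lebesgue"
    "\<And>i j. i \<in> I \<Longrightarrow> j \<in> I \<Longrightarrow> i \<noteq> j \<Longrightarrow> negligible (S i \<inter> S j)"
  shows "cone_measure (\<Union>i\<in>I. S i) = (\<Sum>i\<in>I. cone_measure (S i))"
proof -
  have "measure lebesgue (\<Union>i\<in>I. S i \<inter> cball 0 1) = (\<Sum>i\<in>I. measure lebesgue (S i \<inter> cball 0 1))"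
  proof (rule measure_negligible_finite_Union_image)
    show "pairwise (\<lambda>i j. negligible ((S i \<inter> cball 0 1) \<inter> (S j \<inter> cball 0 1))) I"
      unfolding pairwise_def using assms(3) by (blast intro: negligible_subset)
  qed (use assms cone_lmeasurable in auto)
  then show ?thesis
    by (simp add: cone_measure_def Int_UN_distrib2 Int_commute)
qed

lemma cone_measure_orthogonal_image:
  fixes f :: "real^3 \<Rightarrow> real^3"
  assumes "orthogonal_transformation f" "S \<in> sets lebesgue"
  shows "cone_measure (f ` S) = cone_measure S"
proof -
  have "f ` S \<inter> cball 0 1 = f ` (S \<inter> cball 0 1)"
    using orthogonal_transformation_norm[OF assms(1)] by auto
  then show ?thesis
    using measure_orthogonal_image[OF assms(1) cone_lmeasurable[OF assms(2)]]
    by (simp add: cone_measure_def)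
qed

lemma halfspace_lebesgue [intro]:
  fixes a :: "'a::euclidean_space"
  shows "{x. 0 \<le> a \<bullet> x} \<in> sets lebesgue" "{x. a \<bullet> x \<le> 0} \<in> sets lebesgue"
  by (auto intro!: lebesgue_closedin[of UNIV, simplified] simp: closed_halfspace_ge closed_halfspace_le)

lemma cone_measure_halfspace:
  fixes u :: "real^3"
  assumes "u \<noteq> 0"
  shows "cone_measure {x. 0 \<le> u \<bullet> x} = cone_measure (UNIV :: (real^3) set) / 2"
proof -
  have "negligible ({x. 0 \<le> u \<bullet> x} \<inter> {x. u \<bullet> x \<le> 0})"
    using negligible_hyperplane[of u 0] assms by (auto intro: negligible_subset)
  moreover have "{x. 0 \<le> u \<bullet> x} \<union> {x. u \<bullet> x \<le> 0} = UNIV" by auto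
  ultimately have "cone_measure (UNIV :: (real^3) set) = cone_measure {x. 0 \<le> u \<bullet> x} + cone_measure {x. u \<bullet> x \<le> 0}"
    using cone_measure_Un[of "{x. 0 \<le> u \<bullet> x}" "{x. u \<bullet> x \<le> 0}"] by auto
  moreover have "{x. u \<bullet> x \<le> 0} = uminus ` {x. 0 \<le> u \<bullet> x}"
    by (force simp: image_iff intro: exI[of _ "- x" for x])
  ultimately show ?thesis
    using cone_measure_orthogonal_image[of uminus "{x. 0 \<le> u \<bullet> x}"]
    by (auto simp: orthogonal_transformation_neg[of "\<lambda>x. x", simplified])
qed

text \<open>Cauchy's functional equation on an interval: nonnegativity makes \<open>g\<close>
  monotone, so enclosing \<open>t\<close> between consecutive multiples of \<open>L / n\<close>
  leaves an error of at most \<open>g L / n\<close>.\<close>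

lemma additive_nonneg_imp_linear:
  fixes g :: "real \<Rightarrow> real"
  assumes "0 < L" and nonneg: "\<And>t. 0 \<le> t \<Longrightarrow> t \<le> L \<Longrightarrow> 0 \<le> g t"
    and add: "\<And>s t. 0 \<le> s \<Longrightarrow> 0 \<le> t \<Longrightarrow> s + t \<le> L \<Longrightarrow> g (s + t) = g s + g t"
    and t: "0 \<le> t" "t \<le> L"
  shows "g t = t / L * g L"
proof -
  have g0: "g 0 = 0" using add[of 0 0] \<open>0 < L\<close> by simp
  have mult: "g (real n * s) = real n * g s" if "0 \<le> s" "real n * s \<le> L" for n s
    using that
  proof (induction n)
    case (Suc n)
    have "real n * s \<le> L"
      using Suc.prems by (simp add: algebra_simps)
    moreover have "g (real n * s + s) = g (real n * s) + g s"
      using Suc.prems by (intro add) (auto simp: algebra_simps)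
    ultimately show ?case
      using Suc by (simp add: algebra_simps)
  qed (simp add: g0)
  have mono: "g s \<le> g r" if "0 \<le> s" "s \<le> r" "r \<le> L" for s r
    using add[of s "r - s"] nonneg[of "r - s"] that by auto
  have close: "\<bar>g t - t / L * g L\<bar> \<le> g L / real n" if "n > 0" for n :: nat
  proof -
    define k where "k = nat \<lfloor>t / L * real n\<rfloor>"
    define h where "h = L / real n"
    have h: "0 < h" "real n * h = L" using \<open>0 < L\<close> that by (auto simp: h_def)
    have gh: "g L = real n * g h" using mult[of h n] h by simp
    have "0 \<le> t / L * real n" using t \<open>0 < L\<close> by simp
    then have k: "real k \<le> t / h" "t / h < real k + 1"
      unfolding k_def h_def by (simp_all add: field_simps) linarith+
    then have kt: "real k * h \<le> t" "t < (real k + 1) * h"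
      using h by (auto simp: field_simps)
    have gh0: "0 \<le> g h" using gh nonneg[of L] \<open>0 < L\<close> that by (simp add: zero_le_mult_iff)
    have lower: "real k * g h \<le> g t"
      using mult[of h k] mono[of "real k * h" t] kt t h by simp
    have upper: "g t \<le> (real k + 1) * g h"
    proof (cases "(real k + 1) * h \<le> L")
      case True
      then show ?thesis
        using mult[of h "Suc k"] mono[of t "(real k + 1) * h"] kt t h by (simp add: algebra_simps)
    next
      case False
      then have "real n < real k + 1" using h by (metis mult_less_cancel_right_pos not_le)
      then have "real n \<le> real k" by simp
      then have "real n * g h \<le> (real k + 1) * g h" using gh0 by (intro mult_right_mono) auto
      moreover have "g t \<le> g L" using mono[of t L] t by simp
      ultimately show ?thesis using gh by simp
    qed
    have "t / L * g L = (t / h) * g h"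
      unfolding gh using h \<open>0 < L\<close> that by (simp add: h_def)
    moreover have "real k * g h \<le> (t / h) * g h" "(t / h) * g h \<le> (real k + 1) * g h"
      using mult_right_mono[OF k(1) gh0] mult_right_mono[OF less_imp_le[OF k(2)] gh0] by simp_all
    ultimately have "\<bar>g t - t / L * g L\<bar> \<le> g h"
      using lower upper by (simp add: algebra_simps abs_le_iff)
    also have "g h = g L / real n" using gh that by simp
    finally show ?thesis .
  qed
  have "(\<lambda>n. g L / real n) \<longlonglongrightarrow> 0"
    by (rule lim_const_over_n)
  then have "\<bar>g t - t / L * g L\<bar> \<le> 0"
    by (rule LIMSEQ_le_const) (use close in \<open>auto intro!: exI[of _ 1]\<close>)
  then show ?thesis by simp
qed

text \<open>As a function of the angle the volume is nonnegative and, because rotations preserve it,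
  additive; hence it is linear. The half-space at angle \<open>pi\<close> fixes the factor.\<close>

lemma cone_measure_wedge_orthonormal:
  fixes u w :: "real^3"
  assumes uw: "norm u = 1" "norm w = 1" "u \<bullet> w = 0" and t: "0 \<le> t" "t \<le> pi"
  shows "cone_measure {x. 0 \<le> u \<bullet> x \<and> (cos t *\<^sub>R u + sin t *\<^sub>R w) \<bullet> x \<le> 0}
    = t / (2 * pi) * cone_measure (UNIV :: (real^3) set)"
proof -
  define e where "e s = cos s *\<^sub>R u + sin s *\<^sub>R w" for s
  define A where "A s r = {x. 0 \<le> e s \<bullet> x} \<inter> {x. e r \<bullet> x \<le> 0}" for s r
  define g where "g s = cone_measure (A 0 s)" for s
  have [simp]: "u \<bullet> u = 1" "w \<bullet> w = 1" "w \<bullet> u = 0"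
    using uw by (auto simp: norm_eq_1 inner_commute)
  have A_meas: "A s r \<in> sets lebesgue" for s r
    unfolding A_def by (intro sets.Int) auto
  have e_ne: "e s \<noteq> 0" for s
  proof -
    have "e s \<bullet> e s = 1"
      using uw by (simp add: e_def inner_add_left inner_add_right flip: power2_eq_square)
    then show ?thesis by auto
  qed
  have null: "negligible {x. e s \<bullet> x = 0}" for s
    using e_ne by (intro negligible_hyperplane) auto
  \<comment> \<open>Rotation by \<open>s\<close> in the plane of \<open>u\<close> and
    \<open>w\<close>, written as the identity plus a correction in that plane, so that no third
    basis vector has to be chosen.\<close>
  define \<rho> where "\<rho> s x = x + ((cos s - 1) * (u \<bullet> x) - sin s * (w \<bullet> x)) *\<^sub>R u
      + (sin s * (u \<bullet> x) + (cos s - 1) * (w \<bullet> x)) *\<^sub>R w" for s x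
  have \<rho>u: "u \<bullet> \<rho> s x = cos s * (u \<bullet> x) - sin s * (w \<bullet> x)"
    and \<rho>w: "w \<bullet> \<rho> s x = sin s * (u \<bullet> x) + cos s * (w \<bullet> x)" for s x
    using uw by (simp_all add: \<rho>_def inner_simps algebra_simps)
  have \<rho>_norm: "norm (\<rho> s x) = norm x" for s x
  proof -
    define p q where "p = u \<bullet> x" and "q = w \<bullet> x"
    define a b where "a = (cos s - 1) * p - sin s * q" and "b = sin s * p + (cos s - 1) * q"
    have "\<rho> s x = x + a *\<^sub>R u + b *\<^sub>R w" by (simp add: \<rho>_def a_def b_def p_def q_def)
    then have "\<rho> s x \<bullet> \<rho> s x = x \<bullet> x + 2 * a * p + 2 * b * q + a\<^sup>2 + b\<^sup>2"
      using uw by (simp add: inner_add_left inner_add_right inner_commute[of x u] inner_commute[of x w] p_def q_def power2_eq_square algebra_simps)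
    also have "\<dots> = x \<bullet> x + (cos s ^ 2 + sin s ^ 2 - 1) * (p\<^sup>2 + q\<^sup>2)"
      unfolding a_def b_def by algebra
    finally have "\<rho> s x \<bullet> \<rho> s x = x \<bullet> x" by simp
    then show ?thesis by (simp add: norm_eq_sqrt_inner)
  qed
  have \<rho>_orth: "orthogonal_transformation (\<rho> s)" for s
    unfolding orthogonal_transformation
    using \<rho>_norm by (auto simp: \<rho>_def inner_simps algebra_simps intro!: linearI)
  have rot: "e (s + r) \<bullet> \<rho> s x = e r \<bullet> x" for s r x
  proof -
    have "e (s + r) \<bullet> \<rho> s x = (cos s ^ 2 + sin s ^ 2) * (e r \<bullet> x)"
      unfolding e_def inner_add_left inner_scaleR_left \<rho>u \<rho>w cos_add sin_add
      by algebra
    then show ?thesis by simp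
  qed
  have shift: "cone_measure (A s (s + r)) = g r" for s r
  proof -
    have "A s (s + r) = \<rho> s ` A 0 r"
    proof
      show "\<rho> s ` A 0 r \<subseteq> A s (s + r)"
        using rot[of s 0] rot[of s r] by (auto simp: A_def)
      show "A s (s + r) \<subseteq> \<rho> s ` A 0 r"
      proof
        fix y assume y: "y \<in> A s (s + r)"
        obtain x where "y = \<rho> s x"
          using orthogonal_transformation_surj[OF \<rho>_orth] by (metis surjD)
        then show "y \<in> \<rho> s ` A 0 r"
          using y rot[of s 0 x] rot[of s r x] by (auto simp: A_def)
      qed
    qed
    then show ?thesis
      using cone_measure_orthogonal_image[OF \<rho>_orth A_meas] by (simp add: g_def)
  qed
  have g0: "g 0 = 0"
  proof -
    have "A 0 0 = {x. e 0 \<bullet> x = 0}" by (auto simp: A_def)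
    then have "negligible (A 0 0 \<inter> cball 0 1)" using null by (auto intro: negligible_Int)
    then show ?thesis by (simp add: g_def cone_measure_def negligible_iff_measure)
  qed
  \<comment> \<open>The linear relation between the normals at the angles \<open>0\<close>,
    \<open>s\<close> and \<open>s + r\<close>. All its coefficients are nonnegative in the range
    considered, so the defining inequalities of either smaller wedge imply the missing one of the
    large wedge.\<close>
  have interp: "sin s * (e (s + r) \<bullet> x) = sin (s + r) * (e s \<bullet> x) - sin r * (e 0 \<bullet> x)" for s r x
  proof -
    have "sin (s + r) * (e s \<bullet> x) - sin r * (e 0 \<bullet> x) - sin s * (e (s + r) \<bullet> x)
       = sin r * (u \<bullet> x) * (cos s ^ 2 + sin s ^ 2 - 1)"
      unfolding e_def inner_add_left inner_scaleR_left cos_add sin_add cos_zero sin_zero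
      by algebra
    then show ?thesis by simp
  qed
  have add: "g (s + r) = g s + g r" if sr: "0 \<le> s" "0 \<le> r" "s + r \<le> pi" for s r
  proof (cases "s = 0 \<or> r = 0")
    case True
    then show ?thesis using g0 by auto
  next
    case False
    then have pos: "0 < sin s" "0 < sin r" "0 \<le> sin (s + r)"
      using sr by (auto intro!: sin_gt_zero sin_ge_zero)
    have "A 0 (s + r) = A 0 s \<union> A s (s + r)"
    proof (intro equalityI subsetI)
      fix x assume "x \<in> A 0 s \<union> A s (s + r)"
      then consider "0 \<le> e 0 \<bullet> x" "e s \<bullet> x \<le> 0" | "0 \<le> e s \<bullet> x" "e (s + r) \<bullet> x \<le> 0"
        by (auto simp: A_def)
      then show "x \<in> A 0 (s + r)"
      proof cases
        case 1
        then have "sin s * (e (s + r) \<bullet> x) \<le> 0"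
          unfolding interp using pos by (smt (verit) mult_nonneg_nonneg mult_nonneg_nonpos)
        then show ?thesis using 1 pos by (auto simp: A_def mult_le_0_iff)
      next
        case 2
        then have "0 \<le> sin (s + r) * (e s \<bullet> x) - sin s * (e (s + r) \<bullet> x)"
          using pos by (smt (verit) mult_nonneg_nonneg mult_nonneg_nonpos)
        then have "0 \<le> sin r * (e 0 \<bullet> x)"
          using interp[of s r x] by simp
        then show ?thesis using 2 pos by (auto simp: A_def zero_le_mult_iff)
      qed
    qed (auto simp: A_def)
    moreover have "negligible (A 0 s \<inter> A s (s + r))"
      by (rule negligible_subset[OF null[of s]]) (auto simp: A_def)
    ultimately show ?thesis
      using cone_measure_Un[OF A_meas A_meas] shift by (simp add: g_def)
  qed
  have gpi: "g pi = cone_measure (UNIV :: (real^3) set) / 2"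
  proof -
    have "A 0 pi = {x. 0 \<le> u \<bullet> x}" by (auto simp: A_def e_def)
    moreover have "u \<noteq> 0" using uw by auto
    ultimately show ?thesis by (simp add: g_def cone_measure_halfspace)
  qed
  have "g t = t / pi * (cone_measure (UNIV :: (real^3) set) / 2)"
    unfolding gpi[symmetric]
    by (rule additive_nonneg_imp_linear) (use add t in \<open>auto simp: g_def cone_measure_nonneg\<close>)
  moreover have "A 0 t = {x. 0 \<le> u \<bullet> x \<and> (cos t *\<^sub>R u + sin t *\<^sub>R w) \<bullet> x \<le> 0}"
    by (auto simp: A_def e_def)
  ultimately show ?thesis by (simp add: g_def)
qed

text \<open>\<open>m\<close> and \<open>n\<close> are inward normals, so a wedge of opening
  \<open>t\<close> has normals at angle \<open>pi - t\<close>; this is the minus sign in the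
  hypothesis.\<close>

lemma cone_measure_wedge:
  fixes m n :: "real^3"
  assumes "m \<noteq> 0" "n \<noteq> 0" and t: "0 < t" "t < pi" and "m \<bullet> n = - norm m * norm n * cos t"
  shows "cone_measure {x. 0 \<le> m \<bullet> x \<and> 0 \<le> n \<bullet> x} = t / (2 * pi) * cone_measure (UNIV :: (real^3) set)"
proof -
  have st: "0 < sin t" using t by (rule sin_gt_zero)
  define u where "u = m /\<^sub>R norm m"
  \<comment> \<open>Reversing \<open>n\<close> makes the angle to \<open>u\<close> equal to
    \<open>t\<close>; \<open>w\<close> then comes from Gram-Schmidt.\<close>
  define v where "v = - n /\<^sub>R norm n"
  define w where "w = (v - cos t *\<^sub>R u) /\<^sub>R sin t"
  have uu: "u \<bullet> u = 1" and vv: "v \<bullet> v = 1" and uv: "u \<bullet> v = cos t"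
    using assms by (auto simp: u_def v_def dot_square_norm power2_eq_square field_simps)
  then have "u \<bullet> w = 0" by (simp add: w_def inner_simps)
  moreover have "w \<bullet> w = 1"
  proof -
    have "(v - cos t *\<^sub>R u) \<bullet> (v - cos t *\<^sub>R u) = (sin t)\<^sup>2"
      by (simp add: inner_simps uu vv uv inner_commute[of v u] flip: power2_eq_square sin_squared_eq)
    moreover have "w \<bullet> w = ((v - cos t *\<^sub>R u) \<bullet> (v - cos t *\<^sub>R u)) / (sin t)\<^sup>2"
      by (simp add: w_def power2_eq_square divide_inverse)
    ultimately show ?thesis using st by simp
  qed
  ultimately have "cone_measure {x. 0 \<le> u \<bullet> x \<and> (cos t *\<^sub>R u + sin t *\<^sub>R w) \<bullet> x \<le> 0}
    = t / (2 * pi) * cone_measure (UNIV :: (real^3) set)"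
    using cone_measure_wedge_orthonormal[of u w t] uu t by (auto simp: norm_eq_1)
  moreover have "cos t *\<^sub>R u + sin t *\<^sub>R w = v" using st by (simp add: w_def)
  moreover have "0 \<le> u \<bullet> x \<longleftrightarrow> 0 \<le> m \<bullet> x" "v \<bullet> x \<le> 0 \<longleftrightarrow> 0 \<le> n \<bullet> x" for x
    using assms by (auto simp: u_def v_def zero_le_divide_iff divide_inverse[symmetric] zero_le_mult_iff
        inverse_nonnegative_iff_nonnegative)
  ultimately show ?thesis by simp
qed

subsection \<open>Trihedral cones and Girard's theorem\<close>

unbundle cross3_syntax

lemma negligible_slab:
  fixes a :: "'a::euclidean_space"
  assumes "a \<noteq> 0" "S \<subseteq> {x. a \<bullet> x = 0}"
  shows "negligible S"
  using negligible_hyperplane[of a 0] assms negligible_subset by blast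

lemma cone_measure_diff_halfspace:
  fixes S :: "'a::euclidean_space set"
  assumes "S \<in> sets lebesgue" "n \<noteq> 0"
  shows "cone_measure S = cone_measure (S \<inter> {x. 0 \<le> n \<bullet> x}) + cone_measure (S \<inter> {x. n \<bullet> x \<le> 0})"
proof -
  have "negligible ((S \<inter> {x. 0 \<le> n \<bullet> x}) \<inter> (S \<inter> {x. n \<bullet> x \<le> 0}))"
    by (rule negligible_slab[OF assms(2)]) auto
  moreover have "S = (S \<inter> {x. 0 \<le> n \<bullet> x}) \<union> (S \<inter> {x. n \<bullet> x \<le> 0})" by auto
  ultimately show ?thesis
    using cone_measure_Un[of "S \<inter> {x. 0 \<le> n \<bullet> x}" "S \<inter> {x. n \<bullet> x \<le> 0}"] assms halfspace_lebesgue
    by (metis sets.Int)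
qed

text \<open>The three planes cut the ball into eight pieces, of which opposite ones have equal measure.\<close>

lemma cone_measure_three_halfspaces:
  fixes l m n :: "real^3"
  assumes "l \<noteq> 0" "m \<noteq> 0" "n \<noteq> 0"
  shows "2 * cone_measure {x. 0 \<le> l \<bullet> x \<and> 0 \<le> m \<bullet> x \<and> 0 \<le> n \<bullet> x}
    = cone_measure {x. 0 \<le> l \<bullet> x \<and> 0 \<le> m \<bullet> x} + cone_measure {x. 0 \<le> m \<bullet> x \<and> 0 \<le> n \<bullet> x}
      + cone_measure {x. 0 \<le> n \<bullet> x \<and> 0 \<le> l \<bullet> x} - cone_measure (UNIV :: (real^3) set) / 2"
proof -
  define H where "H a = {x. 0 \<le> a \<bullet> x}" for a :: "real^3"
  define K where "K a = {x. a \<bullet> x \<le> 0}" for a :: "real^3"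
  have [simp, intro]: "H a \<in> sets lebesgue" "K a \<in> sets lebesgue" for a
    unfolding H_def K_def by auto
  have split: "cone_measure S = cone_measure (S \<inter> H a) + cone_measure (S \<inter> K a)"
    if "S \<in> sets lebesgue" "a \<noteq> 0" for S a
    unfolding H_def K_def by (rule cone_measure_diff_halfspace[OF that])
  \<comment> \<open>After one piece is replaced by its antipode, the three pairwise wedges consist
    of the four pieces of \<open>H l\<close>, with the common piece counted three times. Their sum
    is therefore the volume of \<open>H l\<close> plus twice the wanted volume.\<close>
  have "cone_measure (H l) = cone_measure (H l \<inter> H m \<inter> H n) + cone_measure (H l \<inter> H m \<inter> K n)
      + (cone_measure (H l \<inter> K m \<inter> H n) + cone_measure (H l \<inter> K m \<inter> K n))"
    using split[OF _ assms(3), of "H l \<inter> H m"] split[OF _ assms(3), of "H l \<inter> K m"]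
      split[OF _ assms(2), of "H l"] by (simp add: sets.Int)
  moreover have "cone_measure (H l \<inter> H m) = cone_measure (H l \<inter> H m \<inter> H n) + cone_measure (H l \<inter> H m \<inter> K n)"
    by (rule split[OF _ assms(3)]) (simp add: sets.Int)
  moreover have "cone_measure (H n \<inter> H l) = cone_measure (H l \<inter> H m \<inter> H n) + cone_measure (H l \<inter> K m \<inter> H n)"
  proof -
    have "H l \<inter> H m \<inter> H n = (H n \<inter> H l) \<inter> H m" "H l \<inter> K m \<inter> H n = (H n \<inter> H l) \<inter> K m" by auto
    then show ?thesis using split[OF _ assms(2), of "H n \<inter> H l"] by (simp add: sets.Int)
  qed
  moreover have "cone_measure (H m \<inter> H n) = cone_measure (H l \<inter> H m \<inter> H n) + cone_measure (K l \<inter> H m \<inter> H n)"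
  proof -
    have "H l \<inter> H m \<inter> H n = (H m \<inter> H n) \<inter> H l" "K l \<inter> H m \<inter> H n = (H m \<inter> H n) \<inter> K l" by auto
    then show ?thesis using split[OF _ assms(1), of "H m \<inter> H n"] by (simp add: sets.Int)
  qed
  moreover have "cone_measure (K l \<inter> H m \<inter> H n) = cone_measure (H l \<inter> K m \<inter> K n)"
  proof -
    have "K l \<inter> H m \<inter> H n = uminus ` (H l \<inter> K m \<inter> K n)"
    proof (intro equalityI subsetI)
      fix x assume "x \<in> K l \<inter> H m \<inter> H n"
      then have "- x \<in> H l \<inter> K m \<inter> K n" by (simp add: H_def K_def)
      then show "x \<in> uminus ` (H l \<inter> K m \<inter> K n)" by (metis image_eqI minus_minus)
    qed (auto simp: H_def K_def)
    then show ?thesis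
      using cone_measure_orthogonal_image[of uminus "H l \<inter> K m \<inter> K n"]
      by (auto simp: orthogonal_transformation_neg[of "\<lambda>x. x", simplified])
  qed
  moreover have "cone_measure (H l) = cone_measure (UNIV :: (real^3) set) / 2"
    unfolding H_def using assms by (intro cone_measure_halfspace)
  moreover have "{x. 0 \<le> l \<bullet> x \<and> 0 \<le> m \<bullet> x \<and> 0 \<le> n \<bullet> x} = H l \<inter> H m \<inter> H n"
    "{x. 0 \<le> l \<bullet> x \<and> 0 \<le> m \<bullet> x} = H l \<inter> H m" "{x. 0 \<le> m \<bullet> x \<and> 0 \<le> n \<bullet> x} = H m \<inter> H n"
    "{x. 0 \<le> n \<bullet> x \<and> 0 \<le> l \<bullet> x} = H n \<inter> H l"
    by (auto simp: H_def)
  ultimately show ?thesis by (simp add: field_simps)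
qed

lemma cone_measure_UNIV3: "cone_measure (UNIV :: (real^3) set) = 4 / 3 * pi"
  by (simp add: cone_measure_def content_cball unit_ball_vol_3)

section \<open>Determinants and the coordinates of trihedral cones\<close>

definition triple :: "real^3 \<Rightarrow> real^3 \<Rightarrow> real^3 \<Rightarrow> real" where
  "triple a b c = a \<bullet> (b \<times> c)"

lemma triple_rotate: "triple b c a = triple a b c"
  by (simp add: triple_def cross3_simps)

text \<open>Cramer's rule with the denominator cleared, so that it also holds for dependent
  vectors.\<close>

lemma triple_expand:
  "triple a b c *\<^sub>R x = triple x b c *\<^sub>R a + triple a x c *\<^sub>R b + triple a b x *\<^sub>R c"
  by (simp add: triple_def cross3_simps forall_3)

text \<open>The Gram determinant of three unit vectors.\<close>

lemma triple_square:
  assumes "norm a = 1" "norm b = 1" "norm c = 1"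
  shows "(triple a b c)\<^sup>2 = 1 + 2 * (b \<bullet> c) * (c \<bullet> a) * (a \<bullet> b) - (b \<bullet> c)\<^sup>2 - (c \<bullet> a)\<^sup>2 - (a \<bullet> b)\<^sup>2"
proof -
  have "(triple a b c)\<^sup>2 = (a \<bullet> a) * (b \<bullet> b) * (c \<bullet> c) + 2 * (b \<bullet> c) * (c \<bullet> a) * (a \<bullet> b)
    - (a \<bullet> a) * (b \<bullet> c)\<^sup>2 - (b \<bullet> b) * (c \<bullet> a)\<^sup>2 - (c \<bullet> c) * (a \<bullet> b)\<^sup>2"
    by (simp add: triple_def cross3_simps power2_eq_square)
  then show ?thesis using assms by (simp add: norm_eq_1)
qed

definition tricone :: "real^3 \<Rightarrow> real^3 \<Rightarrow> real^3 \<Rightarrow> (real^3) set" where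
  "tricone a b c = {p *\<^sub>R a + q *\<^sub>R b + r *\<^sub>R c | p q r. 0 \<le> p \<and> 0 \<le> q \<and> 0 \<le> r}"

text \<open>The coefficient of \<open>a\<close> may be negative: without the constraint from the
  side \<open>b\<close>, \<open>c\<close> the cone opens to the dihedral wedge along the line
  through \<open>a\<close>, whose volume measures the angle at \<open>a\<close>.\<close>

definition triwedge :: "real^3 \<Rightarrow> real^3 \<Rightarrow> real^3 \<Rightarrow> (real^3) set" where
  "triwedge a b c = {p *\<^sub>R a + q *\<^sub>R b + r *\<^sub>R c | p q r. 0 \<le> q \<and> 0 \<le> r}"

lemma triple_coords:
  "triple (p *\<^sub>R a + q *\<^sub>R b + r *\<^sub>R c) b c = p * triple a b c"
  "triple a (p *\<^sub>R a + q *\<^sub>R b + r *\<^sub>R c) c = q * triple a b c"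
  "triple a b (p *\<^sub>R a + q *\<^sub>R b + r *\<^sub>R c) = r * triple a b c"
  by (simp_all add: triple_def inner_add_left inner_add_right cross_add_left cross_add_right cross_mult_left
      cross_mult_right dot_cross_self)

lemma triple_inner:
  "(b \<times> c) \<bullet> x = triple x b c" "(c \<times> a) \<bullet> x = triple a x c" "(a \<times> b) \<bullet> x = triple a b x"
  by (simp_all add: triple_def cross3_simps)

lemma triple_combination:
  assumes "0 < triple a b c"
  obtains p q r where "x = p *\<^sub>R a + q *\<^sub>R b + r *\<^sub>R c"
proof
  let ?D = "triple a b c"
  have "x = (1 / ?D) *\<^sub>R (?D *\<^sub>R x)" using assms by simp
  also have "\<dots> = (triple x b c / ?D) *\<^sub>R a + (triple a x c / ?D) *\<^sub>R b + (triple a b x / ?D) *\<^sub>R c"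
    by (subst triple_expand) (simp add: scaleR_add_right)
  finally show "x = \<dots>" .
qed

text \<open>Up to the positive factor \<open>triple a b c\<close>, the three cross products are the
  basis dual to \<open>a\<close>, \<open>b\<close>, \<open>c\<close>, so the signs of the inner
  products are those of the coefficients.\<close>

lemma tricone_halfspaces:
  assumes "0 < triple a b c"
  shows "tricone a b c = {x. 0 \<le> (b \<times> c) \<bullet> x \<and> 0 \<le> (c \<times> a) \<bullet> x \<and> 0 \<le> (a \<times> b) \<bullet> x}"
proof (intro equalityI subsetI)
  fix x assume x: "x \<in> {x. 0 \<le> (b \<times> c) \<bullet> x \<and> 0 \<le> (c \<times> a) \<bullet> x \<and> 0 \<le> (a \<times> b) \<bullet> x}"
  obtain p q r where pqr: "x = p *\<^sub>R a + q *\<^sub>R b + r *\<^sub>R c"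
    using triple_combination[OF assms] .
  have "0 \<le> p" "0 \<le> q" "0 \<le> r"
    using x assms unfolding pqr mem_Collect_eq triple_inner(1)[of b c] triple_inner(2)[of c a] triple_inner(3)[of a b] triple_coords
    by (simp_all add: zero_le_mult_iff)
  then show "x \<in> tricone a b c"
    unfolding tricone_def pqr by blast
qed (use assms in \<open>auto simp: tricone_def triple_inner(1)[of b c] triple_inner(2)[of c a] triple_inner(3)[of a b] triple_coords\<close>)

lemma triwedge_halfspaces:
  assumes "0 < triple a b c"
  shows "triwedge a b c = {x. 0 \<le> (c \<times> a) \<bullet> x \<and> 0 \<le> (a \<times> b) \<bullet> x}"
proof (intro equalityI subsetI)
  fix x assume x: "x \<in> {x. 0 \<le> (c \<times> a) \<bullet> x \<and> 0 \<le> (a \<times> b) \<bullet> x}"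
  obtain p q r where pqr: "x = p *\<^sub>R a + q *\<^sub>R b + r *\<^sub>R c"
    using triple_combination[OF assms] .
  have "0 \<le> q" "0 \<le> r"
    using x assms unfolding pqr mem_Collect_eq triple_inner(1)[of b c] triple_inner(2)[of c a] triple_inner(3)[of a b] triple_coords
    by (simp_all add: zero_le_mult_iff)
  then show "x \<in> triwedge a b c"
    unfolding triwedge_def pqr by blast
qed (use assms in \<open>auto simp: triwedge_def triple_inner(1)[of b c] triple_inner(2)[of c a] triple_inner(3)[of a b] triple_coords\<close>)

lemma triple_imp_cross_nonzero:
  assumes "0 < triple a b c"
  shows "b \<times> c \<noteq> 0" "c \<times> a \<noteq> 0" "a \<times> b \<noteq> 0"
  using triple_inner(1)[of b c a] triple_inner(2)[of c a b] triple_inner(3)[of a b c] assms by auto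

text \<open>Girard's formula in volumes: multiplied by 3/2 it reads area = sum of the angles minus
  \<open>pi\<close>.\<close>

lemma cone_measure_tricone:
  assumes "0 < triple a b c"
  shows "2 * cone_measure (tricone a b c)
    = cone_measure (triwedge a b c) + cone_measure (triwedge b c a) + cone_measure (triwedge c a b) - 2 / 3 * pi"
proof -
  have "0 < triple b c a" "0 < triple c a b"
    using assms by (metis triple_rotate)+
  then show ?thesis
    using cone_measure_three_halfspaces[of "b \<times> c" "c \<times> a" "a \<times> b"] triple_imp_cross_nonzero[OF assms]
    by (simp add: assms tricone_halfspaces triwedge_halfspaces cone_measure_UNIV3)
qed

lemma abs_inner_less_1:
  assumes "norm a = 1" "norm b = 1" "0 < triple a b c"
  shows "\<bar>a \<bullet> b\<bar> < 1"
proof -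
  have "(norm (a \<times> b))\<^sup>2 + (a \<bullet> b)\<^sup>2 = 1"
    using norm_cross_dot[of a b] assms by simp
  moreover have "0 < norm (a \<times> b)" using triple_imp_cross_nonzero[OF assms(3)] by simp
  ultimately have "(a \<bullet> b)\<^sup>2 < 1" by (smt (verit) zero_less_power)
  then show ?thesis by (simp add: abs_square_less_1)
qed

lemma polar_upper_half:
  fixes C D :: real
  assumes "0 < D"
  obtains r t where "0 < r" "0 < t" "t < pi" "C = r * cos t" "D = r * sin t"
proof -
  define r where "r = sqrt (C\<^sup>2 + D\<^sup>2)"
  have r: "0 < r" "r\<^sup>2 = C\<^sup>2 + D\<^sup>2"
    using assms by (auto simp: r_def intro!: sum_power2_gt_zero_iff[THEN iffD2])
  have "(C / r)\<^sup>2 + (D / r)\<^sup>2 = 1"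
    using r assms by (simp add: power_divide add_divide_distrib[symmetric])
  then obtain t where t: "0 \<le> t" "t < 2 * pi" "C / r = cos t" "D / r = sin t"
    using sincos_total_2pi by metis
  have "0 < sin t" using assms r t(4) by (metis divide_pos_pos)
  then have "0 < t" "t < pi"
    using t sin_le_zero[of t] by (cases "t = 0"; force)+
  then show thesis
    using that[of r t] r t by (simp add: field_simps)
qed

text \<open>\<open>\<phi>\<close> is the dihedral angle of the cone at the edge through \<open>a\<close>.\<close>

lemma dihedral_angle:
  assumes abc: "norm a = 1" "norm b = 1" "norm c = 1" and D: "0 < triple a b c"
  defines "\<phi> \<equiv> 3 / 2 * cone_measure (triwedge a b c)"
  shows "0 < \<phi>" "\<phi> < pi"
    "sqrt (1 - (c \<bullet> a)\<^sup>2) * sqrt (1 - (a \<bullet> b)\<^sup>2) * cos \<phi> = b \<bullet> c - (c \<bullet> a) * (a \<bullet> b)"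
    "sqrt (1 - (c \<bullet> a)\<^sup>2) * sqrt (1 - (a \<bullet> b)\<^sup>2) * sin \<phi> = triple a b c"
proof -
  let ?m = "c \<times> a" and ?n = "a \<times> b"
  have nm: "norm ?m = sqrt (1 - (c \<bullet> a)\<^sup>2)" "norm ?n = sqrt (1 - (a \<bullet> b)\<^sup>2)"
    using norm_cross_dot[of c a] norm_cross_dot[of a b] abc by (simp_all add: real_sqrt_unique flip: eq_diff_eq)
  have nc: "(norm ?m)\<^sup>2 = 1 - (c \<bullet> a)\<^sup>2" "(norm ?n)\<^sup>2 = 1 - (a \<bullet> b)\<^sup>2"
    using norm_cross_dot[of c a] norm_cross_dot[of a b] abc by simp_all
  have pos: "0 < norm ?m" "0 < norm ?n" using triple_imp_cross_nonzero[OF D] by auto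
  have inn: "?m \<bullet> ?n = (c \<bullet> a) * (a \<bullet> b) - b \<bullet> c"
    using abc by (simp add: dot_cross norm_eq_1 inner_commute mult.commute)
  define X where "X = norm ?m * norm ?n"
  have X: "0 < X" using pos by (simp add: X_def)
  \<comment> \<open>The numerators of the spherical cosine and sine formulas have modulus
    \<open>X\<close>. Hence they have a polar angle \<open>t\<close>, and the wedge formula
    identifies \<open>t\<close> with the angle defined by volume.\<close>
  have X2: "X\<^sup>2 = (b \<bullet> c - (c \<bullet> a) * (a \<bullet> b))\<^sup>2 + (triple a b c)\<^sup>2"
  proof -
    have "X\<^sup>2 = (norm ?m)\<^sup>2 * (norm ?n)\<^sup>2" by (simp add: X_def power_mult_distrib)
    also have "\<dots> = (1 - (c \<bullet> a)\<^sup>2) * (1 - (a \<bullet> b)\<^sup>2)"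
      unfolding nc by simp
    also have "\<dots> = (b \<bullet> c - (c \<bullet> a) * (a \<bullet> b))\<^sup>2 + (triple a b c)\<^sup>2"
      unfolding triple_square[OF abc] by (simp add: power2_eq_square algebra_simps)
    finally show ?thesis .
  qed
  obtain r t where t: "0 < r" "0 < t" "t < pi"
    "b \<bullet> c - (c \<bullet> a) * (a \<bullet> b) = r * cos t" "triple a b c = r * sin t"
    using polar_upper_half[OF D] .
  have "X\<^sup>2 = r\<^sup>2"
    unfolding X2 t(4,5) by (simp add: power_mult_distrib flip: distrib_left)
  then have rX: "r = X" using X t(1) by (simp add: power2_eq_iff_nonneg)
  have "cone_measure {x. 0 \<le> ?m \<bullet> x \<and> 0 \<le> ?n \<bullet> x} = t / (2 * pi) * (4 / 3 * pi)"
    unfolding cone_measure_UNIV3[symmetric]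
    using pos t rX inn by (intro cone_measure_wedge) (auto simp: X_def algebra_simps)
  then have "t = \<phi>" using D by (simp add: \<phi>_def triwedge_halfspaces)
  then show "0 < \<phi>" "\<phi> < pi"
    "sqrt (1 - (c \<bullet> a)\<^sup>2) * sqrt (1 - (a \<bullet> b)\<^sup>2) * cos \<phi> = b \<bullet> c - (c \<bullet> a) * (a \<bullet> b)"
    "sqrt (1 - (c \<bullet> a)\<^sup>2) * sqrt (1 - (a \<bullet> b)\<^sup>2) * sin \<phi> = triple a b c"
    using t rX unfolding nm[symmetric] X_def[symmetric] by auto
qed

subsection \<open>Volume bounds for a single facet\<close>

text \<open>Equal doubled phases determine an angle modulo \<open>pi\<close> only; the ranges remove
  this ambiguity.\<close>

lemma half_angle_unique:
  fixes e t :: real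
  assumes "cos (2 * e) = cos (2 * t)" "sin (2 * e) = sin (2 * t)" "0 \<le> e" "e < pi" "0 < t" "t < pi"
  shows "e = t"
proof -
  have "cos (2 * e - 2 * t) = 1"
    unfolding cos_diff assms(1,2) by (simp flip: power2_eq_square)
  then have "sin (e - t) = 0"
    using cos_double_sin[of "e - t"] by (simp add: algebra_simps)
  then show ?thesis
    using sin_eq_0_pi[of "e - t"] assms by simp
qed

lemma amgm3:
  fixes u v w :: real
  assumes "0 \<le> u" "0 \<le> v" "0 \<le> w"
  shows "u * v * w \<le> ((u + v + w) / 3) ^ 3"
proof -
  have "0 \<le> (u + v + w) * ((u - v)\<^sup>2 + (v - w)\<^sup>2 + (w - u)\<^sup>2) / 2
      + 3 * (u * (v - w)\<^sup>2 + v * (w - u)\<^sup>2 + w * (u - v)\<^sup>2)"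
    using assms by (intro add_nonneg_nonneg mult_nonneg_nonneg divide_nonneg_nonneg) auto
  also have "\<dots> = (u + v + w) ^ 3 - 27 * (u * v * w)"
    by (simp add: power2_eq_square power3_eq_cube field_simps)
  finally show ?thesis by (simp add: power_divide)
qed

text \<open>The Gram determinant equals \<open>2 * (1 + x) * (1 + y) * (1 + z) - C\<^sup>2\<close>,
  so for fixed \<open>C\<close> the claim is the inequality of arithmetic and geometric means, with
  equality at \<open>x = y = z\<close>.\<close>

lemma gram_det_le:
  fixes x y z :: real
  assumes "-1 \<le> x" "-1 \<le> y" "-1 \<le> z"
  defines "C \<equiv> 1 + x + y + z"
  shows "27 * (1 + 2 * x * y * z - x\<^sup>2 - y\<^sup>2 - z\<^sup>2) \<le> (4 - C)\<^sup>2 * (1 + 2 * C)"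
proof -
  have "(1 + x) * (1 + y) * (1 + z) \<le> ((1 + x + (1 + y) + (1 + z)) / 3) ^ 3"
    using assms by (intro amgm3) auto
  then have "27 * ((1 + x) * (1 + y) * (1 + z)) \<le> (3 + x + y + z) ^ 3"
    by (simp add: power_divide algebra_simps)
  moreover have "(4 - C)\<^sup>2 * (1 + 2 * C) - 27 * (1 + 2 * x * y * z - x\<^sup>2 - y\<^sup>2 - z\<^sup>2)
      = 2 * ((3 + x + y + z) ^ 3 - 27 * ((1 + x) * (1 + y) * (1 + z)))"
    unfolding C_def by algebra
  ultimately show ?thesis by simp
qed

text \<open>The extremal configuration is the regular one, \<open>C = (3 y\<^sup>2 - 1) / 2\<close> and \<open>D = y (3 - y\<^sup>2) / 2\<close>;
  an arbitrary configuration with the same angle is a multiple \<open>k\<close> of it.\<close>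

lemma det_le_regular:
  fixes C D e r :: real
  assumes CD: "C = r * cos e" "D = r * sin e" "0 < r" and e: "0 < e" "e < pi"
    and C4: "C \<le> 4" and bound: "27 * D\<^sup>2 \<le> (4 - C)\<^sup>2 * (1 + 2 * C)"
  shows "D \<le> 3 / 2 * (tan ((pi - e) / 3) * (1 - (tan ((pi - e) / 3))\<^sup>2 / 3))"
proof -
  \<comment> \<open>Since \<open>e = pi - 3 * t\<close>, the triple-angle formulas express the
    direction of \<open>e\<close> through \<open>y = tan t\<close> alone.\<close>
  define t where "t = (pi - e) / 3"
  define y where "y = tan t"
  have e_eq: "e = pi - 3 * t" unfolding t_def by (simp add: field_simps)
  have t: "0 < t" "t < pi / 3" using e by (auto simp: t_def)
  have ct: "0 < cos t" and st: "0 < sin t" using t by (auto intro!: cos_gt_zero_pi sin_gt_zero)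
  have y0: "0 < y" using ct st by (simp add: y_def tan_def)
  have y3: "y\<^sup>2 < 3"
  proof -
    have "tan t < tan (pi / 3)" using t by (intro tan_monotone) auto
    then have "y < sqrt 3" by (simp add: y_def tan_60)
    then have "y\<^sup>2 < (sqrt 3)\<^sup>2" using y0 by (intro power_strict_mono) auto
    then show ?thesis by simp
  qed
  have st': "sin t = y * cos t" using ct by (simp add: y_def tan_def)
  have cc: "(cos t)\<^sup>2 * (1 + y\<^sup>2) = 1"
    using sin_cos_squared_add[of t] by (simp add: st' power_mult_distrib algebra_simps)
  have cos3: "cos (3 * t) = (cos t) ^ 3 * (1 - 3 * y\<^sup>2)"
  proof -
    have "cos (3 * t) = 4 * cos t ^ 3 - 3 * cos t" by (rule cos_treble_cos)
    also have "\<dots> = 4 * cos t ^ 3 - 3 * cos t * ((cos t)\<^sup>2 * (1 + y\<^sup>2))" by (simp add: cc)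
    finally show ?thesis by (simp add: algebra_simps power2_eq_square power3_eq_cube)
  qed
  have sin3: "sin (3 * t) = (cos t) ^ 3 * (3 * y - y ^ 3)"
  proof -
    have "sin (3 * t) = sin (2 * t) * cos t + cos (2 * t) * sin t"
      using sin_add[of "2 * t" t] by simp
    also have "\<dots> = 2 * sin t * cos t * cos t + ((cos t)\<^sup>2 - (sin t)\<^sup>2) * sin t"
      by (simp only: sin_double cos_double)
    also have "\<dots> = (cos t) ^ 3 * (3 * y - y ^ 3)"
      unfolding st' by (simp add: algebra_simps power2_eq_square power3_eq_cube)
    finally show ?thesis .
  qed
  define C' where "C' = (3 * y\<^sup>2 - 1) / 2"
  define D' where "D' = y * (3 - y\<^sup>2) / 2"
  have D'0: "0 < D'" using y0 y3 by (simp add: D'_def)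
  define k where "k = D / D'"
  have DkD: "D = k * D'" using D'0 by (simp add: k_def)
  have Dpos: "0 < D" using CD e by (simp add: sin_gt_zero)
  have CkC: "C = k * C'"
  proof -
    have "D * cos e = C * sin e" using CD by simp
    then have "D * ((cos t) ^ 3 * (3 * y\<^sup>2 - 1)) = C * ((cos t) ^ 3 * (3 * y - y ^ 3))"
      unfolding e_eq cos_diff sin_diff cos3 sin3 by (simp add: right_diff_distrib)
    then have "(cos t) ^ 3 * (D * C') = (cos t) ^ 3 * (C * D')"
      by (simp add: C'_def D'_def field_simps power2_eq_square power3_eq_cube)
    then have "D * C' = C * D'" using ct by simp
    then show ?thesis using D'0 by (simp add: k_def field_simps)
  qed
  \<comment> \<open>The regular configuration attains equality in the hypothesis
    \<open>bound\<close>.\<close>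
  have D'2: "27 * D'\<^sup>2 = (4 - C')\<^sup>2 * (1 + 2 * C')"
    by (simp add: C'_def D'_def power2_eq_square field_simps)
  have C'bd: "-1/2 \<le> C'" "C' \<le> 4" using y3 by (auto simp: C'_def)
  have Chalf: "-1/2 \<le> C"
  proof (rule ccontr)
    assume "\<not> ?thesis"
    then have "(4 - C)\<^sup>2 * (1 + 2 * C) \<le> 0" by (intro mult_nonneg_nonpos) auto
    then show False using bound Dpos by (smt (verit) zero_less_power)
  qed
  have "k \<le> 1"
  proof (rule ccontr)
    assume "\<not> ?thesis"
    \<comment> \<open>Comparing \<open>bound\<close> at \<open>(k * C', k * D')\<close> with
      \<open>k\<^sup>2\<close> times the equality at \<open>(C', D')\<close> leaves the factor
      \<open>k - 1\<close> times a polynomial. That polynomial is positive because \<open>C\<close>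
      lies between -1/2 and 4.\<close>
    then have k: "1 < k" by simp
    have "(k - 1) * (16 * (k + 1) + 24 * C' * k - 2 * C' ^ 3 * k\<^sup>2)
        = k\<^sup>2 * ((4 - C')\<^sup>2 * (1 + 2 * C')) - (4 - k * C')\<^sup>2 * (1 + 2 * (k * C'))"
      by (simp add: power2_eq_square power3_eq_cube algebra_simps)
    also have "\<dots> \<le> 0"
      using bound unfolding D'2[symmetric] by (simp add: CkC[symmetric]) (simp add: DkD power_mult_distrib)
    finally have le: "16 * (k + 1) + 24 * C' * k - 2 * C' ^ 3 * k\<^sup>2 \<le> 0"
      using k by (simp add: mult_le_0_iff)
    have C3: "C' ^ 3 * k\<^sup>2 = C' * C\<^sup>2" by (simp add: CkC power2_eq_square power3_eq_cube)
    show False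
    proof (cases "C' \<le> 0")
      case True
      then have "C' * C\<^sup>2 \<le> 0" by (simp add: mult_nonpos_nonneg)
      then show False using le C3 Chalf k by (simp add: CkC algebra_simps)
    next
      case False
      then have "C' \<le> C" using k by (simp add: CkC)
      have "C\<^sup>2 \<le> 4 * C" using False C4 k by (simp add: power2_eq_square CkC)
      then have "C' * C\<^sup>2 \<le> 4 * (4 * C)"
        using False C'bd by (intro mult_mono) auto
      then show False using le C3 C4 k by (simp add: CkC algebra_simps)
    qed
  qed
  then have "D \<le> D'" using D'0 unfolding DkD by simp
  then show ?thesis by (simp add: D'_def y_def t_def algebra_simps)
qed

text \<open>Half the determinant of the isosceles triangle with apex angle \<open>2 * \<psi>\<close>
  and half area \<open>\<psi> + d\<close>. An equivalent form is \<open>cos \<psi> / sin \<psi> * (1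
  - (cos \<psi>)\<^sup>2 / (cos d)\<^sup>2)\<close>; the one chosen is easier to
  differentiate.\<close>

definition star_bound :: "real \<Rightarrow> real \<Rightarrow> real" where
  "star_bound \<psi> d = sin \<psi> * cos \<psi> - cos \<psi> ^ 3 / sin \<psi> * (tan d)\<^sup>2"

text \<open>Here \<open>y\<close> and \<open>z\<close> are the cosines of the sides adjacent to the angle \<open>\<phi>\<close>, \<open>x\<close> that of the
  opposite side, and \<open>2 e\<close> is the spherical area; equality holds for \<open>y = z\<close>.\<close>

lemma det_le_star_bound:
  fixes x y z D e r \<phi> S :: real
  assumes yz: "\<bar>y\<bar> < 1" "\<bar>z\<bar> < 1" and S: "0 \<le> S" "S\<^sup>2 = (1 - y\<^sup>2) * (1 - z\<^sup>2)"
    and \<phi>: "0 < \<phi>" "\<phi> < pi" "S * cos \<phi> = x - y * z" "S * sin \<phi> = D"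
    and e: "0 < e" "e < pi" "1 + x + y + z = r * cos e" "D = r * sin e" "0 < r"
  shows "e < \<phi>" "D \<le> 2 * star_bound (\<phi> / 2) (e - \<phi> / 2)"
proof -
  define Y where "Y = (1 + y) * (1 + z)"
  define \<psi> where "\<psi> = \<phi> / 2"
  define d where "d = e - \<psi>"
  have Y: "0 < Y" using yz by (simp add: Y_def)
  \<comment> \<open>\<open>1 + x + y + z = (1 + y) * (1 + z) + (x - y * z)\<close>, so in complex
    notation \<open>r exp (i e) = Y + S exp (i \<phi>)\<close>.\<close>
  have re: "r * cos e = Y + S * cos \<phi>" "r * sin e = S * sin \<phi>"
    using \<phi> e by (simp_all add: Y_def algebra_simps)
  have s\<phi>: "0 < sin \<phi>" using \<phi> by (intro sin_gt_zero)
  have "r * sin (\<phi> - e) = sin \<phi> * (r * cos e) - cos \<phi> * (r * sin e)"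
    by (simp add: sin_diff algebra_simps)
  also have "\<dots> = Y * sin \<phi>" unfolding re by (simp add: algebra_simps)
  finally have "0 < sin (\<phi> - e)"
    using Y s\<phi> e(5) by (metis mult_pos_pos zero_less_mult_pos)
  then show less: "e < \<phi>"
    using sin_ge_zero[of "e - \<phi>"] e \<phi> by (smt (verit) sin_minus)
  have \<psi>: "0 < \<psi>" "\<psi> < pi / 2" "\<phi> = 2 * \<psi>" using \<phi> by (auto simp: \<psi>_def)
  have c\<psi>: "0 < cos \<psi>" and s\<psi>: "0 < sin \<psi>" using \<psi> by (auto intro!: cos_gt_zero sin_gt_zero)
  have d: "\<bar>d\<bar> < pi / 2" using less e(1) \<psi> unfolding d_def by linarith
  then have cd: "0 < cos d" by (intro cos_gt_zero_pi) auto
  \<comment> \<open>Real part of the complex identity after multiplication by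
    \<open>exp (- i \<psi>)\<close>, which makes the phases of the two summands opposite.\<close>
  have rd: "r * cos d = (Y + S) * cos \<psi>"
  proof -
    have "r * cos d = (r * cos e) * cos \<psi> + (r * sin e) * sin \<psi>"
      by (simp add: d_def cos_diff algebra_simps)
    also have "\<dots> = Y * cos \<psi> + S * (cos \<phi> * cos \<psi> + sin \<phi> * sin \<psi>)"
      unfolding re by (simp add: algebra_simps)
    also have "cos \<phi> * cos \<psi> + sin \<phi> * sin \<psi> = cos \<psi>"
      using cos_diff[of \<phi> \<psi>] \<psi>(3) by simp
    finally show ?thesis by (simp add: algebra_simps)
  qed
  have YS: "0 < Y + S" using Y S by simp
  \<comment> \<open>The inequality behind the isosceles case: the squares differ by
    \<open>(y - z)\<^sup>2\<close>. It yields \<open>(Y + S)\<^sup>2 \<le> 4 * Y\<close>; the rest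
    of the bound is an identity.\<close>
  have "S \<le> 1 - y * z"
  proof (rule power2_le_imp_le)
    have "0 \<le> (y - z)\<^sup>2" by simp
    then show "S\<^sup>2 \<le> (1 - y * z)\<^sup>2" unfolding S(2) by (simp add: power2_eq_square algebra_simps)
    have "\<bar>y * z\<bar> \<le> 1 * 1" unfolding abs_mult using yz by (intro mult_mono) auto
    then show "0 \<le> 1 - y * z" by auto
  qed
  then have "Y * (Y + 2 * S + (1 - y) * (1 - z)) \<le> Y * 4"
    using Y by (intro mult_left_mono) (auto simp: Y_def algebra_simps)
  moreover have "Y * ((1 - y) * (1 - z)) = S\<^sup>2"
    unfolding S(2) Y_def by (simp add: power2_eq_square algebra_simps)
  ultimately have key: "(Y + S)\<^sup>2 \<le> 4 * Y"
    by (simp add: power2_eq_square algebra_simps)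
  have r2: "r\<^sup>2 = (Y + S)\<^sup>2 - 4 * Y * S * (sin \<psi>)\<^sup>2"
  proof -
    have "r\<^sup>2 = (r * cos e)\<^sup>2 + (r * sin e)\<^sup>2"
      by (simp add: power_mult_distrib distrib_left[symmetric])
    also have "\<dots> = Y\<^sup>2 + 2 * Y * S * cos \<phi> + S\<^sup>2 * ((cos \<phi>)\<^sup>2 + (sin \<phi>)\<^sup>2)"
      unfolding re by algebra
    also have "\<dots> = Y\<^sup>2 + 2 * Y * S * cos \<phi> + S\<^sup>2" by simp
    also have "cos \<phi> = 1 - 2 * (sin \<psi>)\<^sup>2" unfolding \<psi>(3) by (rule cos_double_sin)
    finally show ?thesis by (simp add: power2_eq_square algebra_simps)
  qed
  have "star_bound \<psi> d = cos \<psi> / sin \<psi> * (1 - (cos \<psi>)\<^sup>2 / (cos d)\<^sup>2)"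
  proof -
    have t: "(tan d)\<^sup>2 = 1 / (cos d)\<^sup>2 - 1"
      using cd by (simp add: tan_def power_divide field_simps sin_squared_eq)
    have s: "sin \<psi> * cos \<psi> = cos \<psi> / sin \<psi> * (1 - (cos \<psi>)\<^sup>2)"
      using s\<psi> by (simp add: sin_squared_eq[symmetric]) (simp add: power2_eq_square)
    show ?thesis
      unfolding star_bound_def s t using s\<psi> cd by (simp add: field_simps power2_eq_square power3_eq_cube)
  qed
  also have "(cos \<psi>)\<^sup>2 / (cos d)\<^sup>2 = r\<^sup>2 / (Y + S)\<^sup>2"
  proof -
    have "cos \<psi> / cos d = r / (Y + S)" using rd YS cd by (simp add: field_simps)
    then show ?thesis by (metis power_divide)
  qed
  also have "1 - r\<^sup>2 / (Y + S)\<^sup>2 = 4 * Y * S * (sin \<psi>)\<^sup>2 / (Y + S)\<^sup>2"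
    using YS by (simp add: r2 field_simps)
  finally have "2 * star_bound \<psi> d = (4 * Y) * D / (Y + S)\<^sup>2"
  proof -
    assume eq: "star_bound \<psi> d = cos \<psi> / sin \<psi> * (4 * Y * S * (sin \<psi>)\<^sup>2 / (Y + S)\<^sup>2)"
    have "D = S * (2 * sin \<psi> * cos \<psi>)" unfolding \<phi>(4)[symmetric] \<psi>(3) sin_double ..
    then show ?thesis unfolding eq using s\<psi> by (simp add: power2_eq_square)
  qed
  moreover have "D \<le> (4 * Y) * D / (Y + S)\<^sup>2"
  proof -
    have "0 \<le> D" using S s\<phi> \<phi>(4) by (metis less_imp_le mult_nonneg_nonneg)
    then have "(Y + S)\<^sup>2 * D \<le> 4 * Y * D" using key by (rule mult_right_mono[rotated])
    then show ?thesis using YS by (simp add: field_simps)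
  qed
  ultimately show "D \<le> 2 * star_bound (\<phi> / 2) (e - \<phi> / 2)"
    by (simp add: \<psi>_def d_def)
qed

section \<open>Joint concavity of the bound for a facet at the trivalent vertex\<close>

lemma cos_cubed_over_sin_deriv:
  assumes "sin \<psi> \<noteq> 0"
  shows "((\<lambda>\<psi>. cos \<psi> ^ 3 / sin \<psi>) has_real_derivative
      - (cos \<psi>)\<^sup>2 * (1 + 2 * (sin \<psi>)\<^sup>2) / (sin \<psi>)\<^sup>2) (at \<psi>)"
proof -
  have cc: "(cos \<psi>)\<^sup>2 = 1 - (sin \<psi>)\<^sup>2" by (rule cos_squared_eq)
  have "(3 * (- sin \<psi> * (cos \<psi>)\<^sup>2) * sin \<psi> - (cos \<psi>)^3 * cos \<psi>) = - (cos \<psi>)\<^sup>2 * (1 + 2 * (sin \<psi>)\<^sup>2)"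
    using cc by algebra
  then show ?thesis
    using assms by (auto intro!: derivative_eq_intros simp: field_simps power2_eq_square power3_eq_cube)
qed

lemma cos_cubed_over_sin_deriv2:
  assumes "sin \<psi> \<noteq> 0"
  shows "((\<lambda>\<psi>. - (cos \<psi>)\<^sup>2 * (1 + 2 * (sin \<psi>)\<^sup>2) / (sin \<psi>)\<^sup>2) has_real_derivative
      2 * cos \<psi> * (1 + 2 * sin \<psi> ^ 4) / sin \<psi> ^ 3) (at \<psi>)"
proof -
  \<comment> \<open>A polynomial in \<open>sin \<psi>\<close> and its inverse, which is simpler to
    differentiate.\<close>
  have eq: "- (cos \<psi>)\<^sup>2 * (1 + 2 * (sin \<psi>)\<^sup>2) / (sin \<psi>)\<^sup>2 = 2 * (sin \<psi>)\<^sup>2 - 1 - 1 / (sin \<psi>)\<^sup>2"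
    if "sin \<psi> \<noteq> 0" for \<psi> :: real
    unfolding cos_squared_eq using that by (simp add: field_simps power2_eq_square)
  have "((\<lambda>\<psi>. 2 * (sin \<psi>)\<^sup>2 - 1 - 1 / (sin \<psi>)\<^sup>2) has_real_derivative
      2 * cos \<psi> * (1 + 2 * sin \<psi> ^ 4) / sin \<psi> ^ 3) (at \<psi>)"
    using assms by (auto intro!: derivative_eq_intros simp: field_simps power2_eq_square power3_eq_cube power4_eq_xxxx)
  moreover have "eventually (\<lambda>\<psi>. 2 * (sin \<psi>)\<^sup>2 - 1 - 1 / (sin \<psi>)\<^sup>2 =
      - (cos \<psi>)\<^sup>2 * (1 + 2 * (sin \<psi>)\<^sup>2) / (sin \<psi>)\<^sup>2) (nhds \<psi>)"
  proof -
    have "open {x. sin x \<noteq> (0::real)}"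
      by (intro open_Collect_neq continuous_intros)
    then have "eventually (\<lambda>x. sin x \<noteq> 0) (nhds \<psi>)"
      using assms eventually_nhds by blast
    then show ?thesis by eventually_elim (rule eq[symmetric])
  qed
  ultimately show ?thesis
    by (subst DERIV_cong_ev[OF refl _ refl, symmetric]) auto
qed

lemma tan_squared_deriv:
  assumes "cos d \<noteq> 0"
  shows "((\<lambda>d. (tan d)\<^sup>2) has_real_derivative 2 * tan d * (1 + (tan d)\<^sup>2)) (at d)"
    and "((\<lambda>d. 2 * tan d * (1 + (tan d)\<^sup>2)) has_real_derivative
      2 * (1 + (tan d)\<^sup>2) * (1 + 3 * (tan d)\<^sup>2)) (at d)"
proof -
  have *: "inverse ((cos d)\<^sup>2) = 1 + (tan d)\<^sup>2"
    using assms by (simp add: tan_def power_divide field_simps)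
  show "((\<lambda>d. (tan d)\<^sup>2) has_real_derivative 2 * tan d * (1 + (tan d)\<^sup>2)) (at d)"
    using assms by (auto intro!: derivative_eq_intros simp: *)
  show "((\<lambda>d. 2 * tan d * (1 + (tan d)\<^sup>2)) has_real_derivative
      2 * (1 + (tan d)\<^sup>2) * (1 + 3 * (tan d)\<^sup>2)) (at d)"
    using assms by (auto intro!: derivative_eq_intros simp: *) algebra
qed

lemma psd_quadratic_form:
  fixes A B C a b :: real
  assumes "0 \<le> A" "0 \<le> C" "B\<^sup>2 \<le> A * C"
  shows "0 \<le> A * a\<^sup>2 + 2 * B * a * b + C * b\<^sup>2"
proof (cases "A = 0")
  case True
  then show ?thesis using assms by simp
next
  case False
  have "0 \<le> (A * a + B * b)\<^sup>2 + (A * C - B\<^sup>2) * b\<^sup>2"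
    using assms by simp
  also have "\<dots> = A * (A * a\<^sup>2 + 2 * B * a * b + C * b\<^sup>2)"
    by algebra
  finally show ?thesis using assms False by (simp add: zero_le_mult_iff)
qed

definition star_bound_d1 :: "real \<Rightarrow> real \<Rightarrow> real" where
  "star_bound_d1 \<psi> d = cos (2 * \<psi>) + (cos \<psi>)\<^sup>2 * (1 + 2 * (sin \<psi>)\<^sup>2) / (sin \<psi>)\<^sup>2 * (tan d)\<^sup>2"

definition star_bound_d2 :: "real \<Rightarrow> real \<Rightarrow> real" where
  "star_bound_d2 \<psi> d = - (cos \<psi> ^ 3 / sin \<psi> * (2 * tan d * (1 + (tan d)\<^sup>2)))"

text \<open>Joint concavity of \<open>star_bound\<close>: with \<open>s = sin \<psi>\<close>, \<open>k = cos \<psi>\<close> and \<open>t = tan d\<close>, the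
  determinant of its Hessian is a positive multiple of \<open>(s\<^sup>2 - k\<^sup>2 t\<^sup>2)\<^sup>2\<close>.\<close>

lemma star_bound_tangent:
  fixes \<psi> d \<psi>' d' :: real
  assumes \<psi>: "0 < \<psi>" "\<psi> < pi / 2" and d: "\<bar>d\<bar> < pi / 2"
    and \<psi>': "0 < \<psi>'" "\<psi>' < pi / 2" and d': "\<bar>d'\<bar> < pi / 2"
  shows "star_bound \<psi>' d' \<le> star_bound \<psi> d + star_bound_d1 \<psi> d * (\<psi>' - \<psi>) + star_bound_d2 \<psi> d * (d' - d)"
proof -
  define a b where "a = \<psi>' - \<psi>" and "b = d' - d"
  define P where "P u = \<psi> + u * a" for u
  define Q where "Q u = d + u * b" for u
  define c where "c x = cos x ^ 3 / sin x" for x :: real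
  define c1 where "c1 x = - (cos x)\<^sup>2 * (1 + 2 * (sin x)\<^sup>2) / (sin x)\<^sup>2" for x :: real
  define c2 where "c2 x = 2 * cos x * (1 + 2 * sin x ^ 4) / sin x ^ 3" for x :: real
  define T where "T x = (tan x)\<^sup>2" for x :: real
  define T1 where "T1 x = 2 * tan x * (1 + (tan x)\<^sup>2)" for x :: real
  define T2 where "T2 x = 2 * (1 + (tan x)\<^sup>2) * (1 + 3 * (tan x)\<^sup>2)" for x :: real
  have range: "0 < P u \<and> P u < pi / 2 \<and> \<bar>Q u\<bar> < pi / 2" if "u \<in> {0..1}" for u
  proof -
    have P: "P u = (1 - u) * \<psi> + u * \<psi>'" and Q: "Q u = (1 - u) * d + u * d'"
      by (simp_all add: P_def Q_def a_def b_def algebra_simps)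
    have "P u \<in> {0<..<pi/2}"
      using convexD_alt[of "{0<..<pi/2}" \<psi> \<psi>' u] \<psi> \<psi>' that unfolding P by simp
    moreover have "Q u \<in> {-(pi/2)<..<pi/2}"
    proof -
      have "d \<in> {-(pi/2)<..<pi/2}" "d' \<in> {-(pi/2)<..<pi/2}" using d d' by (auto simp: abs_less_iff)
      then show ?thesis
        using convexD_alt[of "{-(pi/2)<..<pi/2}" d d' u] that unfolding Q by simp
    qed
    ultimately show ?thesis by auto
  qed
  have nz: "0 < sin (P u)" "0 < cos (P u)" "0 < cos (Q u)" if "u \<in> {0..1}" for u
    using range[OF that] by (auto intro!: sin_gt_zero cos_gt_zero_pi)
  have cd: "(c has_real_derivative c1 x) (at x)" "(c1 has_real_derivative c2 x) (at x)" if "sin x \<noteq> 0" for x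
    using cos_cubed_over_sin_deriv[OF that] cos_cubed_over_sin_deriv2[OF that]
    unfolding c_def c1_def c2_def by auto
  have Td: "(T has_real_derivative T1 x) (at x)" "(T1 has_real_derivative T2 x) (at x)" if "cos x \<noteq> 0" for x
    using tan_squared_deriv[OF that] unfolding T_def T1_def T2_def by auto
  \<comment> \<open>The negated bound along the segment joining the two points; \<open>f2\<close> is
    the Hessian form of the negated bound in the direction \<open>(a, b)\<close>, so convexity of
    \<open>f\<close> gives the tangent plane inequality.\<close>
  define f where "f u = c (P u) * T (Q u) - sin (P u) * cos (P u)" for u
  define f1 where "f1 u = a * (c1 (P u) * T (Q u)) + b * (c (P u) * T1 (Q u)) - a * cos (2 * P u)" for u
  define f2 where "f2 u = (4 * sin (P u) * cos (P u) + c2 (P u) * T (Q u)) * a\<^sup>2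
      + 2 * (c1 (P u) * T1 (Q u)) * a * b + c (P u) * T2 (Q u) * b\<^sup>2" for u
  have PQd: "(P has_real_derivative a) (at u)" "(Q has_real_derivative b) (at u)" for u
    unfolding P_def Q_def by (auto intro!: derivative_eq_intros)
  have "f1 0 * (1 - 0) \<le> f 1 - f 0"
  proof (rule f''_imp_f'[of "{0..1}" f f1 f2])
    fix u :: real assume u: "u \<in> {0..1}"
    note chain = DERIV_chain2[OF cd(1) PQd(1)] DERIV_chain2[OF cd(2) PQd(1)]
      DERIV_chain2[OF Td(1) PQd(2)] DERIV_chain2[OF Td(2) PQd(2)]
      DERIV_chain2[OF DERIV_sin PQd(1)] DERIV_chain2[OF DERIV_cos PQd(1)]
    have nz': "sin (P u) \<noteq> 0" "cos (Q u) \<noteq> 0" using nz[OF u] by auto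
    show "(f has_real_derivative f1 u) (at u)"
      unfolding f_def f1_def cos_double
      by (rule chain nz' refl derivative_eq_intros)+ (simp add: power2_eq_square algebra_simps)
    have cos2: "((\<lambda>u. cos (2 * P u)) has_real_derivative - 4 * sin (P u) * cos (P u) * a) (at u)"
      by (rule derivative_eq_intros PQd refl)+ (simp add: sin_double)
    show "(f1 has_real_derivative f2 u) (at u)"
      unfolding f1_def f2_def
      by (rule chain cos2 nz' refl derivative_eq_intros)+ (simp add: power2_eq_square algebra_simps)
    define s k t where "s = sin (P u)" and "k = cos (P u)" and "t = tan (Q u)"
    have s: "0 < s" and k: "0 < k" using nz[OF u] by (auto simp: s_def k_def)
    have sk: "k\<^sup>2 = 1 - s\<^sup>2" unfolding s_def k_def by (rule cos_squared_eq)
    define A where "A = 4 * s * k + 2 * k * (1 + 2 * s ^ 4) / s ^ 3 * t\<^sup>2"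
    define B where "B = - k\<^sup>2 * (1 + 2 * s\<^sup>2) / s\<^sup>2 * (2 * t * (1 + t\<^sup>2))"
    define C where "C = k ^ 3 / s * (2 * (1 + t\<^sup>2) * (1 + 3 * t\<^sup>2))"
    have "0 \<le> A * a\<^sup>2 + 2 * B * a * b + C * b\<^sup>2"
    proof (rule psd_quadratic_form)
      show "0 \<le> A" using s k by (simp add: A_def)
      show "0 \<le> C" using s k by (simp add: C_def)
      have A: "A = 2 * k / s ^ 3 * (2 * s ^ 4 + (1 + 2 * s ^ 4) * t\<^sup>2)"
        using s by (simp add: A_def field_simps eval_nat_numeral)
      have "k ^ 4 / s ^ 4 * (2 * (2 * s ^ 4 + (1 + 2 * s ^ 4) * t\<^sup>2) * (2 * (1 + t\<^sup>2) * (1 + 3 * t\<^sup>2))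
          - ((1 + 2 * s\<^sup>2) * (2 * t * (1 + t\<^sup>2)))\<^sup>2) = A * C - B\<^sup>2"
        using s unfolding A B_def C_def by (simp add: field_simps eval_nat_numeral)
      moreover have "2 * (2 * s ^ 4 + (1 + 2 * s ^ 4) * t\<^sup>2) * (2 * (1 + t\<^sup>2) * (1 + 3 * t\<^sup>2))
          - ((1 + 2 * s\<^sup>2) * (2 * t * (1 + t\<^sup>2)))\<^sup>2 = 8 * (1 + t\<^sup>2) * (s\<^sup>2 - k\<^sup>2 * t\<^sup>2)\<^sup>2"
        unfolding sk by algebra
      moreover have "0 \<le> k ^ 4 / s ^ 4 * (8 * (1 + t\<^sup>2) * (s\<^sup>2 - k\<^sup>2 * t\<^sup>2)\<^sup>2)"
        using s k by simp
      ultimately have "0 \<le> A * C - B\<^sup>2" by (simp only:)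
      then show "B\<^sup>2 \<le> A * C" by simp
    qed
    then show "0 \<le> f2 u"
      by (simp add: f2_def A_def B_def C_def c_def c1_def c2_def T_def T1_def T2_def s_def k_def t_def)
  qed auto
  moreover have "f 0 = - star_bound \<psi> d" "f 1 = - star_bound \<psi>' d'"
    by (simp_all add: f_def star_bound_def c_def T_def P_def Q_def a_def b_def)
  moreover have "f1 0 = - (star_bound_d1 \<psi> d * a + star_bound_d2 \<psi> d * b)"
    by (simp add: f1_def star_bound_d1_def star_bound_d2_def c_def c1_def T_def T1_def P_def Q_def
        algebra_simps flip: add_divide_distrib)
  ultimately show ?thesis by (simp add: a_def b_def)
qed

text \<open>The tangent plane is taken at the mean \<open>(pi / 3, D)\<close>, where the linear
  terms cancel in the sum. The bound on each \<open>d i\<close> keeps \<open>D\<close> inside the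
  domain of concavity.\<close>

lemma star_bound_jensen:
  fixes \<psi> d :: "'i \<Rightarrow> real"
  assumes I: "card I = 3" and sum: "sum \<psi> I = pi"
    and range: "\<And>i. i \<in> I \<Longrightarrow> \<psi> i < pi / 2" "\<And>i. i \<in> I \<Longrightarrow> \<bar>d i\<bar> < \<psi> i"
  shows "(\<Sum>i\<in>I. 2 * star_bound (\<psi> i) (d i)) \<le> 3 * sqrt 3 / 2 * (1 - 1 / 3 * (tan (sum d I / 3))\<^sup>2)"
proof -
  define D where "D = sum d I / 3"
  have "\<bar>sum d I\<bar> \<le> (\<Sum>i\<in>I. \<bar>d i\<bar>)" by (rule sum_abs)
  also have "\<dots> \<le> sum \<psi> I" using range by (intro sum_mono less_imp_le)
  finally have D: "\<bar>D\<bar> < pi / 2" using sum pi_gt_zero unfolding D_def by linarith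
  have "(\<Sum>i\<in>I. star_bound (\<psi> i) (d i))
      \<le> (\<Sum>i\<in>I. star_bound (pi / 3) D + star_bound_d1 (pi / 3) D * (\<psi> i - pi / 3) + star_bound_d2 (pi / 3) D * (d i - D))"
  proof (rule sum_mono)
    fix i assume "i \<in> I"
    then show "star_bound (\<psi> i) (d i)
      \<le> star_bound (pi / 3) D + star_bound_d1 (pi / 3) D * (\<psi> i - pi / 3) + star_bound_d2 (pi / 3) D * (d i - D)"
      using range[of i] D by (intro star_bound_tangent) auto
  qed
  also have "\<dots> = 3 * star_bound (pi / 3) D"
    by (simp add: sum.distrib sum_distrib_left[symmetric] sum_subtractf sum I D_def)
  also have "star_bound (pi / 3) D = sqrt 3 / 4 * (1 - 1 / 3 * (tan D)\<^sup>2)"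
  proof -
    have "cos (pi / 3) ^ 3 / sin (pi / 3) = sqrt 3 / 12"
      by (simp add: sin_60 cos_60 power3_eq_cube field_simps)
    moreover have "sin (pi / 3) * cos (pi / 3) = sqrt 3 / 4" by (simp add: sin_60 cos_60)
    ultimately show ?thesis by (simp only: star_bound_def) (simp add: algebra_simps)
  qed
  finally show ?thesis by (simp add: sum_distrib_left[symmetric] D_def)
qed

text \<open>At \<open>t = (pi - e) / 3\<close>, the complement of half the angle of the regular
  triangle of half area \<open>e\<close>, this is 2/3 of that triangle's determinant, hence four
  times the volume of its pyramid.\<close>

definition facet_bound :: "real \<Rightarrow> real" where
  "facet_bound t = tan t * (1 - (tan t)\<^sup>2 / 3)"

text \<open>Concavity: the derivative is \<open>(1 - y\<^sup>2) * (1 + y\<^sup>2)\<close> with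
  \<open>y = tan t\<close>, which decreases on the interval.\<close>

lemma facet_bound_tangent:
  assumes "0 < t" "t < pi / 2" "0 < u" "u < pi / 2"
  shows "facet_bound u \<le> facet_bound t + (1 - tan t ^ 4) * (u - t)"
proof -
  have "- (1 - tan t ^ 4) * (u - t) \<le> - facet_bound u - (- facet_bound t)"
  proof (rule f''_imp_f'[of "{0<..<pi/2}" "\<lambda>t. - facet_bound t" "\<lambda>t. - (1 - tan t ^ 4)"
        "\<lambda>t. 4 * tan t ^ 3 * (1 + (tan t)\<^sup>2)"])
    fix x :: real assume x: "x \<in> {0<..<pi/2}"
    then have c: "cos x \<noteq> 0" using cos_gt_zero_pi[of x] by auto
    have *: "inverse ((cos x)\<^sup>2) = 1 + (tan x)\<^sup>2"
      using c by (simp add: tan_def power_divide field_simps)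
    have tan: "(tan has_real_derivative 1 + (tan x)\<^sup>2) (at x)"
      using DERIV_tan[OF c] by (simp add: *)
    show "((\<lambda>t. - facet_bound t) has_real_derivative - (1 - tan x ^ 4)) (at x)"
    proof -
      have "((\<lambda>y. - (y * (1 - y\<^sup>2 / 3))) has_real_derivative - (1 - (tan x)\<^sup>2)) (at (tan x))"
        by (auto intro!: derivative_eq_intros simp: field_simps power2_eq_square)
      from DERIV_chain2[OF this tan] show ?thesis
        unfolding facet_bound_def by (simp add: algebra_simps eval_nat_numeral)
    qed
    show "((\<lambda>t. - (1 - tan t ^ 4)) has_real_derivative 4 * tan x ^ 3 * (1 + (tan x)\<^sup>2)) (at x)"
      using c by (auto intro!: derivative_eq_intros simp: *)
    show "0 \<le> 4 * tan x ^ 3 * (1 + (tan x)\<^sup>2)"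
      using x tan_gt_zero[of x] by simp
  qed (use assms in auto)
  then show ?thesis by (simp add: algebra_simps)
qed

lemma facet_bound_jensen:
  fixes t :: "'i \<Rightarrow> real"
  assumes "finite I" "I \<noteq> {}" and t: "\<And>i. i \<in> I \<Longrightarrow> 0 < t i \<and> t i < pi / 2"
  shows "(\<Sum>i\<in>I. facet_bound (t i)) \<le> real (card I) * facet_bound (sum t I / real (card I))"
proof -
  define m where "m = sum t I / real (card I)"
  have card: "0 < card I" using assms by (simp add: card_gt_0_iff)
  have "0 < sum t I" using assms by (intro sum_pos) auto
  moreover have "sum t I < real (card I) * (pi / 2)"
    using assms by (intro sum_bounded_above_strict) auto
  ultimately have m: "0 < m" "m < pi / 2"
    using card by (auto simp: m_def field_simps)
  have "(\<Sum>i\<in>I. facet_bound (t i)) \<le> (\<Sum>i\<in>I. facet_bound m + (1 - tan m ^ 4) * (t i - m))"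
    using m t by (intro sum_mono facet_bound_tangent) auto
  also have "\<dots> = real (card I) * facet_bound m"
    using card by (simp add: sum.distrib sum_distrib_left[symmetric] sum_subtractf m_def)
  finally show ?thesis by (simp add: m_def)
qed

subsection \<open>Area and determinant\<close>

text \<open>The product of the three dihedral phases is \<open>-(C + i D)\<^sup>2\<close> up to a positive factor, where
  \<open>C = 1 + a \<bullet> b + b \<bullet> c + c \<bullet> a\<close>, while by Girard's theorem it is minus the phase of the area.\<close>

lemma triangle_area:
  assumes abc: "norm a = 1" "norm b = 1" "norm c = 1" and D: "0 < triple a b c"
  defines "e \<equiv> 3 / 2 * cone_measure (tricone a b c)"
  obtains r where "0 < r" "0 < e" "e < pi" "1 + b \<bullet> c + c \<bullet> a + a \<bullet> b = r * cos e" "triple a b c = r * sin e"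
proof -
  define x y z where "x = b \<bullet> c" and "y = c \<bullet> a" and "z = a \<bullet> b"
  define E where "E = triple a b c"
  define C where "C = 1 + x + y + z"
  define A B G where "A = 3 / 2 * cone_measure (triwedge a b c)"
    and "B = 3 / 2 * cone_measure (triwedge b c a)" and "G = 3 / 2 * cone_measure (triwedge c a b)"
  have rot: "triple b c a = E" "triple c a b = E" by (simp_all add: E_def triple_def cross3_simps)
  have E2: "E\<^sup>2 = 1 + 2 * x * y * z - x\<^sup>2 - y\<^sup>2 - z\<^sup>2"
    unfolding E_def x_def y_def z_def by (rule triple_square[OF abc])
  have lt1: "\<bar>x\<bar> < 1" "\<bar>y\<bar> < 1" "\<bar>z\<bar> < 1"
    using abs_inner_less_1[of b c a] abs_inner_less_1[of c a b] abs_inner_less_1[of a b c] abc D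
    by (auto simp: x_def y_def z_def E_def[symmetric] rot)
  have sq: "x\<^sup>2 < 1" "y\<^sup>2 < 1" "z\<^sup>2 < 1" using lt1 by (simp_all add: abs_square_less_1)
  define X Y Z where "X = sqrt (1 - x\<^sup>2)" and "Y = sqrt (1 - y\<^sup>2)" and "Z = sqrt (1 - z\<^sup>2)"
  have pos: "0 < X" "0 < Y" "0 < Z" using sq by (auto simp: X_def Y_def Z_def)
  have angA: "0 < A" "A < pi" "Y * Z * cos A = x - y * z" "Y * Z * sin A = E"
    using dihedral_angle[OF abc D] unfolding A_def Y_def Z_def x_def y_def z_def E_def by auto
  have angB: "0 < B" "B < pi" "Z * X * cos B = y - z * x" "Z * X * sin B = E"
    using dihedral_angle[of b c a] abc D rot unfolding B_def X_def Z_def x_def y_def z_def E_def by auto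
  have angG: "0 < G" "G < pi" "X * Y * cos G = z - x * y" "X * Y * sin G = E"
    using dihedral_angle[of c a b] abc D rot unfolding G_def X_def Y_def x_def y_def z_def E_def by auto
  have girard: "2 * e = A + B + G - pi"
    using cone_measure_tricone[OF D] by (simp add: e_def A_def B_def G_def)
  have e0: "0 \<le> e" by (simp add: e_def cone_measure_nonneg)
  \<comment> \<open>Only \<open>2 * e\<close> enters Girard's formula; confining \<open>e\<close> to
    one period of length \<open>pi\<close> lets the phase of \<open>(C + i E)\<^sup>2\<close>
    determine it.\<close>
  have epi: "e < pi" using girard angA angB angG by linarith
  \<comment> \<open>The product of the squared sines of the sides clears the denominators of all
    three angles, so the phase of their sum becomes polynomial in \<open>x\<close>,
    \<open>y\<close>, \<open>z\<close> and \<open>E\<close>; \<open>K\<close> is the positive factor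
    by which it differs from the phase of a square.\<close>
  define Q where "Q = (X * Y * Z)\<^sup>2"
  have Q: "0 < Q" using pos by (simp add: Q_def)
  define K where "K = (1 - x) * (1 - y) * (1 - z) / 2"
  have K: "0 < K" using lt1 by (simp add: K_def abs_less_iff)
  have cosG: "Q * cos (A + B + G) = (x - y * z) * (y - z * x) * (z - x * y)
      - E * E * (x - y * z) - E * E * (y - z * x) - E * E * (z - x * y)"
  proof -
    have "Q * cos (A + B + G)
        = (Y * Z * cos A) * (Z * X * cos B) * (X * Y * cos G) - (Z * X * sin B) * (X * Y * sin G) * (Y * Z * cos A)
        - (X * Y * sin G) * (Y * Z * sin A) * (Z * X * cos B) - (Y * Z * sin A) * (Z * X * sin B) * (X * Y * cos G)"
      unfolding Q_def cos_add sin_add by algebra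
    then show ?thesis by (simp only: angA angB angG)
  qed
  have sinG: "Q * sin (A + B + G) = E * (y - z * x) * (z - x * y) + E * (z - x * y) * (x - y * z)
      + E * (x - y * z) * (y - z * x) - E * E * E"
  proof -
    have "Q * sin (A + B + G)
        = (Y * Z * sin A) * (Z * X * cos B) * (X * Y * cos G) + (Z * X * sin B) * (X * Y * cos G) * (Y * Z * cos A)
        + (X * Y * sin G) * (Y * Z * cos A) * (Z * X * cos B) - (Y * Z * sin A) * (Z * X * sin B) * (X * Y * sin G)"
      unfolding Q_def cos_add sin_add by algebra
    then show ?thesis by (simp only: angA angB angG)
  qed
  have re: "Q * cos (2 * e) = K * (C\<^sup>2 - E\<^sup>2)"
  proof -
    have "Q * cos (2 * e) = - (Q * cos (A + B + G))" unfolding girard by (simp add: cos_diff)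
    also have "\<dots> = K * (C\<^sup>2 - E\<^sup>2)" unfolding cosG power2_eq_square[of E, symmetric] E2 K_def C_def
      by (simp add: field_simps power2_eq_square)
    finally show ?thesis .
  qed
  have im: "Q * sin (2 * e) = K * (2 * C * E)"
  proof -
    have "Q * sin (2 * e) = - (Q * sin (A + B + G))" unfolding girard by (simp add: sin_diff)
    also have "\<dots> = - E * ((x - y * z) * (y - z * x) + (y - z * x) * (z - x * y)
      + (z - x * y) * (x - y * z) - E\<^sup>2)" unfolding sinG by algebra
    also have "\<dots> = K * (2 * C * E)" unfolding E2 K_def C_def by (simp add: field_simps power2_eq_square)
    finally show ?thesis .
  qed
  have E0: "0 < E" using D by (simp add: E_def)
  obtain r t where t: "0 < r" "0 < t" "t < pi" "C = r * cos t" "E = r * sin t"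
    using polar_upper_half[OF E0] .
  have re': "Q * cos (2 * e) = (K * r\<^sup>2) * cos (2 * t)"
    unfolding re unfolding t(4,5) cos_double[of t] by algebra
  have im': "Q * sin (2 * e) = (K * r\<^sup>2) * sin (2 * t)"
    unfolding im unfolding t(4,5) sin_double[of t] by algebra
  \<comment> \<open>Comparing moduli removes the positive factors; only the equality of the doubled
    phases remains.\<close>
  have "Q\<^sup>2 * ((cos (2 * e))\<^sup>2 + (sin (2 * e))\<^sup>2) = (K * r\<^sup>2)\<^sup>2 * ((cos (2 * t))\<^sup>2 + (sin (2 * t))\<^sup>2)"
    using re' im' by algebra
  then have "Q\<^sup>2 = (K * r\<^sup>2)\<^sup>2" by (simp only: sin_cos_squared_add2 mult_1_right)
  then have QK: "Q = K * r\<^sup>2" using Q K t by (simp add: power2_eq_iff_nonneg)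
  have "e = t"
  proof (rule half_angle_unique)
    show "cos (2 * e) = cos (2 * t)" "sin (2 * e) = sin (2 * t)"
      using re' im' Q unfolding QK[symmetric] by simp_all
  qed (use e0 epi t in auto)
  then show thesis using that[of r] t by (simp add: C_def x_def y_def z_def E_def)
qed

subsection \<open>The fan over the facets\<close>

definition facet_cone :: "(real^3) set \<Rightarrow> (real^3) set" where
  "facet_cone F = {t *\<^sub>R x | t x. 0 \<le> t \<and> x \<in> F}"

text \<open>The cone swept along the line of \<open>v\<close>. This form does not depend on a
  labelling of the other two vertices and allows a wedge to be reduced to its cone by a
  translation.\<close>

definition facet_wedge :: "(real^3) set \<Rightarrow> real^3 \<Rightarrow> (real^3) set" where
  "facet_wedge F v = {x. \<exists>s. x + s *\<^sub>R v \<in> facet_cone F}"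

lemma facet_cone_triangle: "facet_cone (convex hull {a, b, c}) = tricone a b c"
proof (intro equalityI subsetI)
  fix x assume "x \<in> facet_cone (convex hull {a, b, c})"
  then obtain t u v w where "0 \<le> t" "0 \<le> u" "0 \<le> v" "0 \<le> w" "x = t *\<^sub>R (u *\<^sub>R a + v *\<^sub>R b + w *\<^sub>R c)"
    unfolding facet_cone_def convex_hull_3 by blast
  moreover from this have "x = (t * u) *\<^sub>R a + (t * v) *\<^sub>R b + (t * w) *\<^sub>R c"
    by (simp add: scaleR_add_right)
  ultimately show "x \<in> tricone a b c"
    unfolding tricone_def by (blast intro: mult_nonneg_nonneg)
next
  fix x assume "x \<in> tricone a b c"
  then obtain p q r where pqr: "0 \<le> p" "0 \<le> q" "0 \<le> r" "x = p *\<^sub>R a + q *\<^sub>R b + r *\<^sub>R c"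
    unfolding tricone_def by blast
  define t where "t = p + q + r"
  show "x \<in> facet_cone (convex hull {a, b, c})"
  proof (cases "t = 0")
    case True
    then have "p = 0" "q = 0" "r = 0" using pqr by (auto simp: t_def)
    then have "x = 0 *\<^sub>R a" using pqr by simp
    moreover have "a \<in> convex hull {a, b, c}" by (simp add: hull_inc)
    ultimately show ?thesis unfolding facet_cone_def by force
  next
    case False
    then have t: "0 < t" using pqr by (simp add: t_def)
    define y where "y = (p / t) *\<^sub>R a + (q / t) *\<^sub>R b + (r / t) *\<^sub>R c"
    have "y \<in> convex hull {a, b, c}"
      unfolding convex_hull_3 y_def using pqr t
      by (intro CollectI exI[of _ "p / t"] exI[of _ "q / t"] exI[of _ "r / t"])
        (auto simp: t_def add_divide_distrib[symmetric])
    moreover have "x = t *\<^sub>R y" using t pqr(4) by (simp add: y_def scaleR_add_right)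
    ultimately show ?thesis using t unfolding facet_cone_def by force
  qed
qed

lemma facet_wedge_triangle: "facet_wedge (convex hull {a, b, c}) a = triwedge a b c"
  unfolding facet_wedge_def facet_cone_triangle
proof (intro equalityI subsetI)
  fix x assume "x \<in> {x. \<exists>s. x + s *\<^sub>R a \<in> tricone a b c}"
  then obtain s p q r where pqr: "0 \<le> q" "0 \<le> r" "x + s *\<^sub>R a = p *\<^sub>R a + q *\<^sub>R b + r *\<^sub>R c"
    unfolding tricone_def by blast
  have "x = (x + s *\<^sub>R a) - s *\<^sub>R a" by simp
  also have "\<dots> = (p - s) *\<^sub>R a + q *\<^sub>R b + r *\<^sub>R c"
    unfolding pqr(3) by (simp add: scaleR_diff_left)
  finally show "x \<in> triwedge a b c"
    unfolding triwedge_def using pqr by blast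
next
  fix x assume "x \<in> triwedge a b c"
  then obtain p q r where pqr: "0 \<le> q" "0 \<le> r" "x = p *\<^sub>R a + q *\<^sub>R b + r *\<^sub>R c"
    unfolding triwedge_def by blast
  have "x + \<bar>p\<bar> *\<^sub>R a = (p + \<bar>p\<bar>) *\<^sub>R a + q *\<^sub>R b + r *\<^sub>R c"
    using pqr by (simp add: scaleR_add_left)
  moreover have "0 \<le> p + \<bar>p\<bar>" by simp
  ultimately have "x + \<bar>p\<bar> *\<^sub>R a \<in> tricone a b c"
    unfolding tricone_def using pqr by blast
  then show "x \<in> {x. \<exists>s. x + s *\<^sub>R a \<in> tricone a b c}" by blast
qed

text \<open>The two cones differ only by the origin, a null set.\<close>

lemma spherical_area_radial_projection:
  assumes "0 \<notin> F" "facet_cone F \<in> sets lebesgue"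
  shows "spherical_area (radial_projection ` F) = 3 * cone_measure (facet_cone F)"
proof -
  have "{t *\<^sub>R x | t x. 0 < t \<and> t \<le> 1 \<and> x \<in> radial_projection ` F} = (facet_cone F \<inter> cball 0 1) - {0}"
  proof (intro equalityI subsetI)
    fix x assume "x \<in> {t *\<^sub>R x | t x. 0 < t \<and> t \<le> 1 \<and> x \<in> radial_projection ` F}"
    then obtain t y where ty: "0 < t" "t \<le> 1" "y \<in> F" "x = t *\<^sub>R radial_projection y" by blast
    then have "y \<noteq> 0" using assms by auto
    then have "norm x = t" "x = (t / norm y) *\<^sub>R y" "x \<noteq> 0"
      using ty by (auto simp: radial_projection_def divide_inverse)
    moreover have "0 \<le> t / norm y" using ty by simp
    ultimately show "x \<in> (facet_cone F \<inter> cball 0 1) - {0}"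
      using ty unfolding facet_cone_def by fastforce
  next
    fix x assume x: "x \<in> (facet_cone F \<inter> cball 0 1) - {0}"
    then obtain t y where ty: "0 \<le> t" "y \<in> F" "x = t *\<^sub>R y" unfolding facet_cone_def by blast
    with x assms have "0 < norm x" "norm x \<le> 1" "0 < t" "y \<noteq> 0" by auto
    moreover have "x = norm x *\<^sub>R radial_projection y"
      using calculation ty by (simp add: radial_projection_def)
    ultimately show "x \<in> {t *\<^sub>R x | t x. 0 < t \<and> t \<le> 1 \<and> x \<in> radial_projection ` F}"
      using ty by blast
  qed
  moreover have "measure lebesgue ((facet_cone F \<inter> cball 0 1) - {0}) = cone_measure (facet_cone F)"
    unfolding cone_measure_def
    using assms(2) by (intro measure_Diff_null_set) (auto simp: negligible_iff_null_sets[symmetric])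
  ultimately show ?thesis unfolding spherical_area_def by simp
qed

lemma content_tetrahedron:
  fixes a b c :: "real^3"
  assumes "triple a b c \<noteq> 0"
  shows "measure lebesgue (convex hull {0, a, b, c}) = \<bar>triple a b c\<bar> / 6"
proof -
  define f :: "3 \<Rightarrow> real^3" where "f j = (if j = 1 then a else if j = 2 then b else c)" for j
  have ne: "a \<noteq> 0" "b \<noteq> 0" "c \<noteq> 0" "a \<noteq> b" "b \<noteq> c" "a \<noteq> c"
    using assms by (auto simp: triple_def dot_cross_self)
  have "f ` UNIV = {a, b, c}"
    unfolding UNIV_3 by (auto simp: f_def)
  moreover have "inj f"
    unfolding inj_def forall_3 using ne by (simp add: f_def)
  moreover have "{0, a, b, c} - {0} = {a, b, c}" using ne by auto
  ultimately have bij: "bij_betw f UNIV ({0, a, b, c} - {0})"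
    by (simp add: bij_betw_def)
  have "measure lebesgue (convex hull {0, a, b, c})
      = \<bar>det (\<chi> i. \<chi> j. f j $ i - (0 :: real^3) $ i)\<bar> / fact CARD(3)"
    using content_simplex[OF _ _ _ bij] ne
    by (simp add: measure_completion finite_imp_compact_convex_hull compact_imp_closed)
  also have "det (\<chi> i. \<chi> j. f j $ i - (0 :: real^3) $ i) = triple a b c"
    by (simp add: f_def triple_def cross3_simps)
  finally show ?thesis by (simp add: fact_numeral)
qed

section \<open>Facets of the inscribed polytope; tilings of space by their cones and wedges\<close>

locale inscribed_simplicial_polytope =
  fixes P :: "(real^3) set"
  assumes simplicial: "simplicial_3_polytope P"
    and on_sphere: "vertices P \<subseteq> sphere 0 1"
    and origin: "0 \<in> interior P"
begin

lemma polytope: "polytope P"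
  using simplicial by (simp add: simplicial_3_polytope_def)

lemma norm_vertex: "v \<in> vertices P \<Longrightarrow> norm v = 1"
  using on_sphere by auto

definition facets :: "(real^3) set set" where
  "facets = {F. F facet_of P}"

lemma finite_facets: "finite facets"
  unfolding facets_def by (rule finite_polytope_facets[OF polytope])

text \<open>A small multiple of the normal lies in \<open>P\<close> because the origin is interior,
  so the offset of the supporting plane is positive and can be scaled to 1. The resulting
  \<open>n\<close> is the vertex of the polar body dual to \<open>F\<close>.\<close>

lemma facet_functional:
  assumes "F \<in> facets"
  obtains n where "P \<subseteq> {x. n \<bullet> x \<le> 1}" "F = P \<inter> {x. n \<bullet> x = 1}"
proof -
  obtain a b where ab: "a \<noteq> 0" "P \<subseteq> {x. a \<bullet> x \<le> b}" "F = P \<inter> {x. a \<bullet> x = b}"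
    using facet_of_polyhedron[OF polytope_imp_polyhedron[OF polytope]] assms unfolding facets_def by blast
  obtain d where d: "0 < d" "cball 0 d \<subseteq> P"
    using origin mem_interior_cball by blast
  have "(d / norm a) *\<^sub>R a \<in> P" using d ab(1) by (intro subsetD[OF d(2)]) simp
  then have "a \<bullet> ((d / norm a) *\<^sub>R a) \<le> b" using ab(2) by auto
  moreover have "0 < a \<bullet> ((d / norm a) *\<^sub>R a)" using d ab(1) by simp
  ultimately have b: "0 < b" by linarith
  show thesis
  proof (rule that[of "a /\<^sub>R b"])
    show "P \<subseteq> {x. (a /\<^sub>R b) \<bullet> x \<le> 1}"
      using ab(2) b by (auto simp: field_simps)
    show "F = P \<inter> {x. (a /\<^sub>R b) \<bullet> x = 1}"
      unfolding ab(3) using b by (auto simp: field_simps)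
  qed
qed

lemma zero_notin_facet: "F \<in> facets \<Longrightarrow> 0 \<notin> F"
  by (erule facet_functional) auto

lemma facet_vertices:
  assumes F: "F \<in> facets"
  obtains C where "\<not> affine_dependent C" "card C = 3" "F = convex hull C" "vertices P \<inter> F = C"
proof -
  have "2 simplex F" "F face_of P"
    using F simplicial by (auto simp: facets_def simplicial_3_polytope_def facet_of_imp_face_of)
  then obtain C where C: "\<not> affine_dependent C" "card C = 3" "F = convex hull C"
    unfolding simplex_def by auto
  have "vertices P \<inter> F = C"
    unfolding vertices_def
    using extreme_point_of_face[OF \<open>F face_of P\<close>] extreme_point_of_convex_hull_affine_independent[OF C(1)] C(3)
    by blast
  then show thesis using that C by blast
qed

text \<open>The facet plane misses the origin, so affine independence of the vertices becomes linear
  independence; exchanging \<open>b\<close> and \<open>c\<close> if necessary makes the determinant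
  positive.\<close>

lemma facet_triple:
  assumes F: "F \<in> facets" and v: "v \<in> vertices P" "v \<in> F"
  obtains b c where "F = convex hull {v, b, c}" "vertices P \<inter> F = {v, b, c}" "v \<noteq> b" "v \<noteq> c" "b \<noteq> c"
    "0 < triple v b c" "norm v = 1" "norm b = 1" "norm c = 1"
proof -
  obtain C where C: "\<not> affine_dependent C" "card C = 3" "F = convex hull C" "vertices P \<inter> F = C"
    using facet_vertices[OF F] .
  have "v \<in> C" using C v by blast
  then have "card (C - {v}) = 2" using C(2) by simp
  then obtain b c where "C - {v} = {b, c}" and bc: "b \<noteq> c" by (meson card_2_iff)
  then have Ceq: "C = {v, b, c}" and vb: "v \<noteq> b" "v \<noteq> c" using \<open>v \<in> C\<close> by auto
  have nrm: "norm v = 1" "norm b = 1" "norm c = 1"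
    using C(4) Ceq norm_vertex by blast+
  obtain n where n: "F = P \<inter> {x. n \<bullet> x = 1}" using facet_functional[OF F] by metis
  have n1: "n \<bullet> v = 1" "n \<bullet> b = 1" "n \<bullet> c = 1" using C(4) Ceq n by blast+
  have cross: "b \<times> c \<noteq> 0"
  proof
    assume "b \<times> c = 0"
    then obtain k where "c = k *\<^sub>R b"
      using nrm unfolding cross_eq_0 collinear_lemma by auto
    then show False using n1 bc by auto
  qed
  have "triple v b c \<noteq> 0"
  proof
    assume 0: "triple v b c = 0"
    \<comment> \<open>Cramer's identity applied to \<open>b \<times> c\<close> gives a nontrivial
      linear relation when the determinant vanishes. Since \<open>n\<close> equals 1 at all three
      vertices, the coefficients add up to 0, so the relation is an affine one.\<close>
    define p q r where "p = triple (b \<times> c) b c" and "q = triple v (b \<times> c) c" and "r = triple v b (b \<times> c)"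
    have "p = (b \<times> c) \<bullet> (b \<times> c)" by (simp add: p_def triple_def)
    then have p: "p \<noteq> 0" using cross by simp
    have dep: "p *\<^sub>R v + q *\<^sub>R b + r *\<^sub>R c = 0"
      using triple_expand[of v b c "b \<times> c"] 0 by (simp add: p_def q_def r_def)
    then have "n \<bullet> (p *\<^sub>R v + q *\<^sub>R b + r *\<^sub>R c) = 0" by simp
    then have sum: "p + q + r = 0" by (simp add: inner_add_right n1)
    define U where "U x = (if x = v then p else if x = b then q else r)" for x
    have "affine_dependent C"
      unfolding affine_dependent_explicit_finite[OF card_ge_0_finite[of C, unfolded C(2), simplified]]
      by (rule exI[of _ U]) (use dep sum p vb bc in \<open>auto simp: Ceq U_def add.assoc\<close>)
    then show False using C(1) by blast
  qed
  then consider "0 < triple v b c" | "0 < triple v c b"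
    by (metis cross_skew inner_minus_right linorder_neqE_linordered_idom neg_0_less_iff_less triple_def)
  then show thesis
  proof cases
    case 1
    then show ?thesis using that[of b c] C Ceq vb bc nrm by blast
  next
    case 2
    moreover have "{v, b, c} = {v, c, b}" by blast
    ultimately show ?thesis using that[of c b] C Ceq vb bc nrm by metis
  qed
qed

lemma facet_some_triple:
  assumes F: "F \<in> facets"
  obtains a b c where "F = convex hull {a, b, c}" "vertices P \<inter> F = {a, b, c}" "a \<noteq> b" "a \<noteq> c" "b \<noteq> c"
    "0 < triple a b c" "norm a = 1" "norm b = 1" "norm c = 1"
proof -
  obtain C where C: "card C = 3" "vertices P \<inter> F = C"
    using facet_vertices[OF F] by metis
  then have "C \<noteq> {}" by auto
  then obtain v where "v \<in> vertices P" "v \<in> F" using C by blast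
  from facet_triple[OF F this] show thesis using that by metis
qed

lemma facet_cone_lebesgue:
  assumes "F \<in> facets"
  shows "closed (facet_cone F)" "facet_cone F \<in> sets lebesgue"
proof -
  obtain a b c where abc: "F = convex hull {a, b, c}" "0 < triple a b c"
    using facet_some_triple[OF assms] by metis
  have "facet_cone F = {x. 0 \<le> (b \<times> c) \<bullet> x} \<inter> {x. 0 \<le> (c \<times> a) \<bullet> x} \<inter> {x. 0 \<le> (a \<times> b) \<bullet> x}"
    unfolding abc(1) facet_cone_triangle tricone_halfspaces[OF abc(2)] by auto
  then show "closed (facet_cone F)" by (auto intro!: closed_Int closed_halfspace_ge)
  then show "facet_cone F \<in> sets lebesgue"
    using lebesgue_closedin[of UNIV] by auto
qed

lemma facet_wedge_lebesgue:
  assumes "F \<in> facets" "v \<in> vertices P" "v \<in> F"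
  shows "facet_wedge F v \<in> sets lebesgue"
proof -
  obtain b c where abc: "F = convex hull {v, b, c}" "0 < triple v b c"
    using facet_triple[OF assms] by metis
  have "facet_wedge F v = {x. 0 \<le> (c \<times> v) \<bullet> x} \<inter> {x. 0 \<le> (v \<times> b) \<bullet> x}"
    unfolding abc(1) facet_wedge_triangle triwedge_halfspaces[OF abc(2)] by auto
  then show ?thesis by (auto intro!: sets.Int)
qed

text \<open>The ray from the origin through a nonzero point leaves \<open>P\<close> in some facet.
  The origin lies in every cone, and this also supplies the facet needed there.\<close>

lemma UN_facet_cone: "(\<Union>F\<in>facets. facet_cone F) = UNIV"
proof -
  have nonzero: "\<exists>F\<in>facets. x \<in> facet_cone F" if x0: "x \<noteq> 0" for x
  proof -
    obtain d where d: "0 < d" "0 + d *\<^sub>R x \<in> frontier P"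
      using ray_to_frontier[OF polytope_imp_bounded[OF polytope] origin x0] by metis
    have "frontier P = rel_frontier P"
      using rel_frontier_nonempty_interior[of P] origin by blast
    then obtain F where F: "F \<in> facets" "d *\<^sub>R x \<in> F"
      using d rel_frontier_of_polyhedron[OF polytope_imp_polyhedron[OF polytope]] unfolding facets_def by auto
    have "x = (1 / d) *\<^sub>R (d *\<^sub>R x)" using d by simp
    moreover have "0 \<le> 1 / d" using d by simp
    ultimately have "x \<in> facet_cone F" unfolding facet_cone_def using F by blast
    then show ?thesis using F by blast
  qed
  obtain F y where "F \<in> facets" "y \<in> F"
    using nonzero[of "axis 1 1"] unfolding facet_cone_def by (auto simp: axis_eq_0_iff)
  then have "\<exists>F\<in>facets. 0 \<in> facet_cone F"
    unfolding facet_cone_def by (force intro: exI[of _ "0::real"])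
  with nonzero show ?thesis by blast
qed

text \<open>The functional of \<open>F\<close> gives \<open>p + q + r \<le> t\<close> and that of
  \<open>F'\<close> gives the converse. Equality with positive coefficients forces all vertices of
  \<open>F\<close> into \<open>F'\<close>, and a face of a convex set with the same dimension is the
  whole set.\<close>

lemma facet_cone_interior_unique:
  assumes F: "F \<in> facets" "F' \<in> facets" and abc: "F = convex hull {a, b, c}"
    and pqr: "0 < p" "0 < q" "0 < r" "p *\<^sub>R a + q *\<^sub>R b + r *\<^sub>R c \<in> facet_cone F'"
  shows "F = F'"
proof -
  obtain n where n: "P \<subseteq> {x. n \<bullet> x \<le> 1}" "F = P \<inter> {x. n \<bullet> x = 1}"
    using facet_functional[OF F(1)] .
  obtain m where m: "P \<subseteq> {x. m \<bullet> x \<le> 1}" "F' = P \<inter> {x. m \<bullet> x = 1}"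
    using facet_functional[OF F(2)] .
  obtain t y where ty: "0 \<le> t" "y \<in> F'" "p *\<^sub>R a + q *\<^sub>R b + r *\<^sub>R c = t *\<^sub>R y"
    using pqr(4) unfolding facet_cone_def by blast
  have inF: "a \<in> F" "b \<in> F" "c \<in> F" unfolding abc by (simp_all add: hull_inc)
  have my: "m \<bullet> y = 1" "n \<bullet> y \<le> 1" using ty m n by auto
  have abc1: "m \<bullet> a \<le> 1" "m \<bullet> b \<le> 1" "m \<bullet> c \<le> 1" "n \<bullet> a = 1" "n \<bullet> b = 1" "n \<bullet> c = 1"
    using inF m(1) n(2) by auto
  have "n \<bullet> (p *\<^sub>R a + q *\<^sub>R b + r *\<^sub>R c) = t * (n \<bullet> y)" unfolding ty(3) by simp
  then have "p + q + r = t * (n \<bullet> y)" by (simp add: inner_add_right abc1)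
  also have "\<dots> \<le> t" using mult_left_mono[OF my(2) ty(1)] by simp
  finally have le: "p + q + r \<le> t" .
  have "m \<bullet> (p *\<^sub>R a + q *\<^sub>R b + r *\<^sub>R c) = t * (m \<bullet> y)" unfolding ty(3) by simp
  then have "p * (m \<bullet> a) + q * (m \<bullet> b) + r * (m \<bullet> c) = t" by (simp add: inner_add_right my)
  moreover have "p * (m \<bullet> a) \<le> p" "q * (m \<bullet> b) \<le> q" "r * (m \<bullet> c) \<le> r"
    using pqr abc1 by (simp_all add: mult_le_cancel_left1)
  ultimately have "p * (m \<bullet> a) = p" "q * (m \<bullet> b) = q" "r * (m \<bullet> c) = r" using le by linarith+
  then have "m \<bullet> a = 1" "m \<bullet> b = 1" "m \<bullet> c = 1" using pqr by auto
  then have "{a, b, c} \<subseteq> F'" using inF m(2) n(2) by auto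
  moreover have F'face: "F' face_of P" using F(2) by (simp add: facets_def facet_of_imp_face_of)
  ultimately have "F \<subseteq> F'"
    unfolding abc using polytope_imp_convex[OF polytope] by (intro hull_minimal) (auto simp: face_of_imp_convex)
  moreover have "F face_of P" using F(1) by (simp add: facets_def facet_of_imp_face_of)
  ultimately have "F face_of F'"
    using F'face face_of_subset face_of_imp_subset by blast
  moreover have "aff_dim F = aff_dim F'"
    using F by (simp add: facets_def facet_of_def)
  ultimately show "F = F'"
    using face_of_aff_dim_lt[of F' F] face_of_imp_convex[OF F'face] by auto
qed

lemma negligible_Int_facet_cone:
  assumes F: "F \<in> facets" "F' \<in> facets" "F \<noteq> F'"
  shows "negligible (facet_cone F \<inter> facet_cone F')"
proof -
  obtain a b c where abc: "F = convex hull {a, b, c}" "0 < triple a b c"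
    using facet_some_triple[OF F(1)] by metis
  have "facet_cone F \<inter> facet_cone F' \<subseteq> {x. (b \<times> c) \<bullet> x = 0} \<union> {x. (c \<times> a) \<bullet> x = 0} \<union> {x. (a \<times> b) \<bullet> x = 0}"
  proof
    fix x assume x: "x \<in> facet_cone F \<inter> facet_cone F'"
    then obtain p q r where pqr: "0 \<le> p" "0 \<le> q" "0 \<le> r" "x = p *\<^sub>R a + q *\<^sub>R b + r *\<^sub>R c"
      unfolding abc facet_cone_triangle tricone_def by blast
    then have "p = 0 \<or> q = 0 \<or> r = 0"
      using facet_cone_interior_unique[OF F(1,2) abc(1), of p q r] x F(3) by force
    then show "x \<in> {x. (b \<times> c) \<bullet> x = 0} \<union> {x. (c \<times> a) \<bullet> x = 0} \<union> {x. (a \<times> b) \<bullet> x = 0}"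
      unfolding pqr(4) mem_Collect_eq Un_iff triple_inner(1)[of b c] triple_inner(2)[of c a] triple_inner(3)[of a b] triple_coords by auto
  qed
  moreover have "negligible ({x. (b \<times> c) \<bullet> x = 0} \<union> {x. (c \<times> a) \<bullet> x = 0} \<union> {x. (a \<times> b) \<bullet> x = 0})"
    using triple_imp_cross_nonzero[OF abc(2)] by (intro negligible_Un negligible_hyperplane) auto
  ultimately show ?thesis using negligible_subset by blast
qed

lemma sum_facet_cone: "(\<Sum>F\<in>facets. cone_measure (facet_cone F)) = 4 / 3 * pi"
  using cone_measure_UN[of facets facet_cone] finite_facets facet_cone_lebesgue negligible_Int_facet_cone
  by (simp add: UN_facet_cone cone_measure_UNIV3)

text \<open>Otherwise \<open>v\<close> would lie strictly between the origin and a point of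
  \<open>F\<close>, against extremality.\<close>

lemma vertex_in_facet_cone:
  assumes F: "F \<in> facets" and v: "v \<in> vertices P" "v \<in> facet_cone F"
  shows "v \<in> F"
proof -
  obtain n where n: "P \<subseteq> {x. n \<bullet> x \<le> 1}" "F = P \<inter> {x. n \<bullet> x = 1}"
    using facet_functional[OF F] .
  obtain t y where ty: "0 \<le> t" "y \<in> F" "v = t *\<^sub>R y"
    using v(2) unfolding facet_cone_def by blast
  have ext: "v extreme_point_of P" using v(1) by (simp add: vertices_def)
  then have "v \<in> P" by (simp add: extreme_point_of_def)
  then have "t \<le> 1" using n(1) ty n(2) by auto
  have "v \<noteq> 0" using norm_vertex[OF v(1)] by auto
  then have "0 < t" "y \<noteq> 0" using ty by (auto simp: less_le)
  show ?thesis
  proof (cases "t = 1")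
    case False
    then have "v \<in> open_segment 0 y"
      unfolding in_segment using \<open>t \<le> 1\<close> \<open>0 < t\<close> \<open>y \<noteq> 0\<close> ty by (auto intro!: exI[of _ t])
    moreover have "0 \<in> P" "y \<in> P" using origin interior_subset ty n(2) by auto
    ultimately show ?thesis using ext by (auto simp: extreme_point_of_def)
  qed (use ty in simp)
qed

lemma facet_cone_add_vertex:
  assumes F: "F \<in> facets" and v: "v \<in> vertices P" "v \<in> F" and x: "x \<in> facet_cone F" and "0 \<le> s"
  shows "x + s *\<^sub>R v \<in> facet_cone F"
proof -
  obtain b c where vbc: "F = convex hull {v, b, c}" using facet_triple[OF F v] by metis
  then obtain p q r where "0 \<le> p" "0 \<le> q" "0 \<le> r" "x = p *\<^sub>R v + q *\<^sub>R b + r *\<^sub>R c"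
    using x unfolding vbc facet_cone_triangle tricone_def by blast
  moreover from this have "x + s *\<^sub>R v = (p + s) *\<^sub>R v + q *\<^sub>R b + r *\<^sub>R c"
    by (simp add: scaleR_add_left)
  ultimately show ?thesis
    unfolding vbc facet_cone_triangle tricone_def using \<open>0 \<le> s\<close> by (blast intro: add_nonneg_nonneg)
qed

text \<open>Moving \<open>x\<close> along \<open>v\<close> by all natural numbers, some facet cone
  is met infinitely often, as there are finitely many facets. Rescaling and closedness put
  \<open>v\<close> into this cone, so that facet belongs to the star.\<close>

lemma UN_facet_wedge:
  assumes v: "v \<in> vertices P"
  shows "(\<Union>F\<in>facets_at P v. facet_wedge F v) = UNIV"
proof -
  have "x \<in> (\<Union>F\<in>facets_at P v. facet_wedge F v)" for x
  proof -
    have "\<exists>F\<in>facets. x + real n *\<^sub>R v \<in> facet_cone F" for n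
      using UN_facet_cone by blast
    then obtain G where G: "\<And>n. G n \<in> facets" "\<And>n. x + real n *\<^sub>R v \<in> facet_cone (G n)"
      by metis
    have "finite (range G)" using G(1) finite_facets by (meson finite_subset image_subsetI)
    then obtain n0 where inf: "infinite {n. G n = G n0}"
      using pigeonhole_infinite[of UNIV G] by auto
    define F where "F = G n0"
    have F: "F \<in> facets" using G by (simp add: F_def)
    have cone: "\<exists>n>k. x + real n *\<^sub>R v \<in> facet_cone F" for k
    proof -
      obtain n where "n > k" "G n = G n0"
        using inf unfolding infinite_nat_iff_unbounded by auto
      then show ?thesis using G(2)[of n] by (auto simp: F_def)
    qed
    then obtain n where n: "\<And>k. n k > k" "\<And>k. x + real (n k) *\<^sub>R v \<in> facet_cone F" by metis
    have "v \<in> facet_cone F"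
    proof (rule closed_sequentially[OF facet_cone_lebesgue(1)[OF F]])
      show "(1 / real (n k)) *\<^sub>R x + v \<in> facet_cone F" for k
      proof -
        obtain t y where ty: "0 \<le> t" "y \<in> F" "x + real (n k) *\<^sub>R v = t *\<^sub>R y"
          using n(2)[of k] unfolding facet_cone_def by blast
        have nk: "0 < real (n k)" using n(1)[of k] by simp
        then have "(1 / real (n k)) *\<^sub>R x + v = (1 / real (n k)) *\<^sub>R (x + real (n k) *\<^sub>R v)"
          by (simp add: scaleR_add_right)
        then have "(1 / real (n k)) *\<^sub>R x + v = (t / real (n k)) *\<^sub>R y" unfolding ty(3) by simp
        moreover have "0 \<le> t / real (n k)" using ty by simp
        ultimately show "(1 / real (n k)) *\<^sub>R x + v \<in> facet_cone F"
          unfolding facet_cone_def using ty by blast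
      qed
      have "(\<lambda>k. 1 / real (n k)) \<longlonglongrightarrow> 0"
      proof (rule tendsto_sandwich[of "\<lambda>_. 0" _ _ "\<lambda>k. 1 / real k"])
        show "eventually (\<lambda>k. 1 / real (n k) \<le> 1 / real k) sequentially"
          using eventually_gt_at_top[of 0]
        proof eventually_elim
          case (elim k)
          then show ?case using n(1)[of k] by (intro divide_left_mono) auto
        qed
      qed (auto simp: lim_1_over_n)
      then have "(\<lambda>k. (1 / real (n k)) *\<^sub>R x + v) \<longlonglongrightarrow> 0 *\<^sub>R x + v"
        by (intro tendsto_intros)
      then show "(\<lambda>k. (1 / real (n k)) *\<^sub>R x + v) \<longlonglongrightarrow> v" by simp
    qed
    then have "v \<in> F" using vertex_in_facet_cone[OF F v] by blast
    moreover have "x \<in> facet_wedge F v" unfolding facet_wedge_def using n(2) by blast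
    ultimately show ?thesis using F by (auto simp: facets_at_def facets_def)
  qed
  then show ?thesis by blast
qed

lemma negligible_Int_facet_wedge:
  assumes v: "v \<in> vertices P" and F: "F \<in> facets_at P v" "F' \<in> facets_at P v" "F \<noteq> F'"
  shows "negligible (facet_wedge F v \<inter> facet_wedge F' v)"
proof -
  have F': "F \<in> facets" "v \<in> F" "F' \<in> facets" "v \<in> F'" using F by (auto simp: facets_at_def facets_def)
  obtain b c where vbc: "F = convex hull {v, b, c}" "0 < triple v b c"
    using facet_triple[OF F'(1) v F'(2)] by metis
  have "facet_wedge F v \<inter> facet_wedge F' v \<subseteq> {x. (c \<times> v) \<bullet> x = 0} \<union> {x. (v \<times> b) \<bullet> x = 0}"
  proof
    fix x assume x: "x \<in> facet_wedge F v \<inter> facet_wedge F' v"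
    then obtain p q r where pqr: "0 \<le> q" "0 \<le> r" "x = p *\<^sub>R v + q *\<^sub>R b + r *\<^sub>R c"
      unfolding vbc facet_wedge_triangle triwedge_def by blast
    obtain s where s: "x + s *\<^sub>R v \<in> facet_cone F'"
      using x unfolding facet_wedge_def by blast
    \<comment> \<open>This shift makes the coefficient of \<open>v\<close> positive without leaving
      the cone of \<open>F'\<close>, so uniqueness for interior points of cones applies.\<close>
    have "x + s *\<^sub>R v + (1 + \<bar>p + s\<bar>) *\<^sub>R v \<in> facet_cone F'"
      by (rule facet_cone_add_vertex[OF F'(3) v F'(4) s]) simp
    moreover have "x + s *\<^sub>R v + (1 + \<bar>p + s\<bar>) *\<^sub>R v = (p + s + (1 + \<bar>p + s\<bar>)) *\<^sub>R v + q *\<^sub>R b + r *\<^sub>R c"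
      unfolding pqr(3) by (simp add: scaleR_add_left)
    moreover have "0 < p + s + (1 + \<bar>p + s\<bar>)" by linarith
    ultimately have "q = 0 \<or> r = 0"
      using facet_cone_interior_unique[OF F'(1,3) vbc(1), of "p + s + (1 + \<bar>p + s\<bar>)" q r] pqr F(3) by force
    then show "x \<in> {x. (c \<times> v) \<bullet> x = 0} \<union> {x. (v \<times> b) \<bullet> x = 0}"
      unfolding pqr(3) mem_Collect_eq Un_iff triple_inner(2)[of c v] triple_inner(3)[of v b] triple_coords by auto
  qed
  moreover have "negligible ({x. (c \<times> v) \<bullet> x = 0} \<union> {x. (v \<times> b) \<bullet> x = 0})"
    using triple_imp_cross_nonzero[OF vbc(2)] by (intro negligible_Un negligible_hyperplane) auto
  ultimately show ?thesis using negligible_subset by blast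
qed

text \<open>With the factor 3/2 this says that the angles at a vertex add up to
  \<open>2 \<pi>\<close>.\<close>

lemma sum_facet_wedge:
  assumes v: "v \<in> vertices P"
  shows "(\<Sum>F\<in>facets_at P v. cone_measure (facet_wedge F v)) = 4 / 3 * pi"
proof -
  have sub: "facets_at P v \<subseteq> facets" "\<And>F. F \<in> facets_at P v \<Longrightarrow> v \<in> F"
    by (auto simp: facets_at_def facets_def)
  then have "finite (facets_at P v)" using finite_facets finite_subset by blast
  then have "cone_measure (\<Union>F\<in>facets_at P v. facet_wedge F v)
      = (\<Sum>F\<in>facets_at P v. cone_measure (facet_wedge F v))"
    by (rule cone_measure_UN) (use sub facet_wedge_lebesgue[OF _ v] negligible_Int_facet_wedge[OF v] in blast)+
  then show ?thesis by (simp only: UN_facet_wedge[OF v] cone_measure_UNIV3)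
qed

lemma facet_girard:
  assumes F: "F \<in> facets"
  shows "2 * cone_measure (facet_cone F) = (\<Sum>v\<in>vertices P \<inter> F. cone_measure (facet_wedge F v)) - 2 / 3 * pi"
proof -
  obtain a b c where abc: "F = convex hull {a, b, c}" "vertices P \<inter> F = {a, b, c}" "a \<noteq> b" "a \<noteq> c" "b \<noteq> c"
    "0 < triple a b c"
    using facet_some_triple[OF F] by metis
  have "{a, b, c} = {b, c, a}" "{a, b, c} = {c, a, b}" by blast+
  then have "facet_wedge F b = triwedge b c a" "facet_wedge F c = triwedge c a b" "facet_wedge F a = triwedge a b c"
    using facet_wedge_triangle[of b c a] facet_wedge_triangle[of c a b] facet_wedge_triangle[of a b c] abc(1) by auto
  then show ?thesis
    using cone_measure_tricone[OF abc(6)] abc by (simp add: facet_cone_triangle)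
qed

text \<open>Summing Girard's formula over all facets (Legendre's proof of Euler's formula).\<close>

lemma card_facets:
  assumes "finite (vertices P)"
  shows "real (card facets) = 2 * real (card (vertices P)) - 4"
proof -
  have "2 * (4 / 3 * pi) = (\<Sum>F\<in>facets. 2 * cone_measure (facet_cone F))"
    by (simp add: sum_facet_cone sum_distrib_left[symmetric])
  also have "\<dots> = (\<Sum>F\<in>facets. (\<Sum>v\<in>vertices P \<inter> F. cone_measure (facet_wedge F v)) - 2 / 3 * pi)"
    by (intro sum.cong refl facet_girard)
  also have "\<dots> = (\<Sum>F\<in>facets. \<Sum>v\<in>{v \<in> vertices P. v \<in> F}. cone_measure (facet_wedge F v))
      - real (card facets) * (2 / 3 * pi)"
    by (simp add: sum_subtractf Int_def)
  also have "(\<Sum>F\<in>facets. \<Sum>v\<in>{v \<in> vertices P. v \<in> F}. cone_measure (facet_wedge F v))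
      = (\<Sum>v\<in>vertices P. \<Sum>F\<in>{F \<in> facets. v \<in> F}. cone_measure (facet_wedge F v))"
    using finite_facets assms by (rule sum.swap_restrict)
  also have "\<dots> = (\<Sum>v\<in>vertices P. 4 / 3 * pi)"
    using sum_facet_wedge by (intro sum.cong refl) (simp add: facets_at_def facets_def)
  finally have "pi * (2 * real (card (vertices P)) - 4 - real (card facets)) = 0"
    by (simp add: algebra_simps)
  then show ?thesis by simp
qed

text \<open>Since only an upper bound on the volume is wanted, it suffices that the pyramids cover
  \<open>P\<close>; the functional of a facet shows that a point of \<open>P\<close> in its cone
  lies in its pyramid.\<close>

lemma measure_le_sum:
  "measure lebesgue P \<le> (\<Sum>F\<in>facets. measure lebesgue (convex hull (insert 0 F)))"
proof -
  have meas: "convex hull (insert 0 F) \<in> lmeasurable" if "F \<in> facets" for F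
  proof -
    have "compact F" using that face_of_polytope_polytope[OF polytope] facet_of_imp_face_of polytope_imp_compact
      unfolding facets_def by blast
    then show ?thesis by (intro lmeasurable_compact compact_convex_hull) auto
  qed
  have "P \<subseteq> (\<Union>F\<in>facets. convex hull (insert 0 F))"
  proof
    fix x assume x: "x \<in> P"
    obtain F where F: "F \<in> facets" "x \<in> facet_cone F" using UN_facet_cone by blast
    then obtain t y where ty: "0 \<le> t" "y \<in> F" "x = t *\<^sub>R y" unfolding facet_cone_def by blast
    obtain n where n: "P \<subseteq> {x. n \<bullet> x \<le> 1}" "F = P \<inter> {x. n \<bullet> x = 1}"
      using facet_functional[OF F(1)] .
    have "t \<le> 1" using n(1) x ty n(2) by auto
    then have "(1 - t) *\<^sub>R 0 + t *\<^sub>R y \<in> convex hull (insert 0 F)"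
      using ty by (intro convexD_alt convex_convex_hull) (auto intro: hull_inc)
    then show "x \<in> (\<Union>F\<in>facets. convex hull (insert 0 F))" using ty F by auto
  qed
  moreover have "P \<in> lmeasurable" using polytope polytope_imp_compact lmeasurable_compact by blast
  moreover have "(\<Union>F\<in>facets. convex hull (insert 0 F)) \<in> lmeasurable"
    using meas finite_facets by (intro fmeasurable.finite_UN) auto
  ultimately have "measure lebesgue P \<le> measure lebesgue (\<Union>F\<in>facets. convex hull (insert 0 F))"
    by (intro measure_mono_fmeasurable) auto
  also have "\<dots> \<le> (\<Sum>F\<in>facets. measure lebesgue (convex hull (insert 0 F)))"
    using meas finite_facets by (intro measure_UNION_le) auto
  finally show ?thesis .
qed

end

subsection \<open>Summation over the facets\<close>

context inscribed_simplicial_polytope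
begin

definition half_area :: "(real^3) set \<Rightarrow> real" where
  "half_area F = 3 / 2 * cone_measure (facet_cone F)"

text \<open>The angle at \<open>v\<close> is 3/2 times the wedge volume; half of it is the variable
  \<open>\<psi>\<close> of \<open>star_bound\<close>.\<close>

definition half_angle :: "(real^3) set \<Rightarrow> real^3 \<Rightarrow> real" where
  "half_angle F v = 3 / 4 * cone_measure (facet_wedge F v)"

lemma facet_area:
  assumes "F \<in> facets"
  shows "spherical_area (radial_projection ` F) = 2 * half_area F"
  using spherical_area_radial_projection[OF zero_notin_facet[OF assms] facet_cone_lebesgue(2)[OF assms]]
  by (simp add: half_area_def)

lemma sum_half_area: "sum half_area facets = 2 * pi"
  unfolding half_area_def sum_distrib_left[symmetric] sum_facet_cone by simp

lemma half_area_bounds: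
  assumes F: "F \<in> facets"
  shows "0 < half_area F" "half_area F < pi"
proof -
  obtain a b c where abc: "F = convex hull {a, b, c}" "0 < triple a b c" "norm a = 1" "norm b = 1" "norm c = 1"
    using facet_some_triple[OF F] .
  from triangle_area[OF abc(3-5,2)] show "0 < half_area F" "half_area F < pi"
    unfolding half_area_def abc(1) facet_cone_triangle by blast+
qed

text \<open>The volume is the determinant divided by 6 and the determinant is at most 3/2 of
  \<open>facet_bound\<close>, hence the factor 1/4.\<close>

lemma measure_facet_pyramid:
  assumes F: "F \<in> facets"
  shows "measure lebesgue (convex hull (insert 0 F)) \<le> facet_bound ((pi - half_area F) / 3) / 4"
proof -
  obtain a b c where abc: "F = convex hull {a, b, c}" "0 < triple a b c" "norm a = 1" "norm b = 1" "norm c = 1"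
    using facet_some_triple[OF F] .
  obtain r where r: "0 < r" "0 < half_area F" "half_area F < pi"
    "1 + b \<bullet> c + c \<bullet> a + a \<bullet> b = r * cos (half_area F)" "triple a b c = r * sin (half_area F)"
    using triangle_area[OF abc(3-5,2)] unfolding half_area_def abc(1) facet_cone_triangle .
  have le1: "\<bar>b \<bullet> c\<bar> \<le> 1" "\<bar>c \<bullet> a\<bar> \<le> 1" "\<bar>a \<bullet> b\<bar> \<le> 1"
    using Cauchy_Schwarz_ineq2[of b c] Cauchy_Schwarz_ineq2[of c a] Cauchy_Schwarz_ineq2[of a b] abc by auto
  have "27 * (triple a b c)\<^sup>2 \<le> (4 - (1 + b \<bullet> c + c \<bullet> a + a \<bullet> b))\<^sup>2 * (1 + 2 * (1 + b \<bullet> c + c \<bullet> a + a \<bullet> b))"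
    unfolding triple_square[OF abc(3-5)] by (rule gram_det_le) (use le1 in \<open>auto simp: abs_le_iff\<close>)
  then have "triple a b c \<le> 3 / 2 * facet_bound ((pi - half_area F) / 3)"
    unfolding facet_bound_def using det_le_regular[OF r(4,5,1,2,3)] le1 by (simp add: abs_le_iff)
  moreover have "convex hull (insert 0 F) = convex hull {0, a, b, c}"
    unfolding abc(1) by (rule hull_insert[symmetric])
  ultimately show ?thesis
    using content_tetrahedron[of a b c] abc(2) by simp
qed

text \<open>The first two conclusions are the domain conditions of \<open>star_bound_jensen\<close>;
  the second holds because half the area is positive and smaller than the angle at
  \<open>v\<close>.\<close>

lemma measure_facet_pyramid_star:
  assumes F: "F \<in> facets" and v: "v \<in> vertices P" "v \<in> F"
  shows "half_angle F v < pi / 2" "\<bar>half_area F - half_angle F v\<bar> < half_angle F v"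
    "measure lebesgue (convex hull (insert 0 F))
      \<le> 2 * star_bound (half_angle F v) (half_area F - half_angle F v) / 6"
proof -
  obtain b c where abc: "F = convex hull {v, b, c}" "0 < triple v b c" "norm v = 1" "norm b = 1" "norm c = 1"
    using facet_triple[OF F v] .
  obtain r where r: "0 < r" "0 < half_area F" "half_area F < pi"
    "1 + b \<bullet> c + c \<bullet> v + v \<bullet> b = r * cos (half_area F)" "triple v b c = r * sin (half_area F)"
    using triangle_area[OF abc(3-5,2)] unfolding half_area_def abc(1) facet_cone_triangle .
  define \<phi> where "\<phi> = 3 / 2 * cone_measure (triwedge v b c)"
  have half: "half_angle F v = \<phi> / 2"
    by (simp add: half_angle_def abc(1) facet_wedge_triangle \<phi>_def)
  define S where "S = sqrt (1 - (c \<bullet> v)\<^sup>2) * sqrt (1 - (v \<bullet> b)\<^sup>2)"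
  have lt1: "\<bar>c \<bullet> v\<bar> < 1" "\<bar>v \<bullet> b\<bar> < 1"
    using abs_inner_less_1[of v b c] abs_inner_less_1[of c v b] abc triple_rotate[of b c v] triple_rotate[of c v b]
    by auto
  then have sq: "(c \<bullet> v)\<^sup>2 < 1" "(v \<bullet> b)\<^sup>2 < 1" by (simp_all add: abs_square_less_1)
  have S: "0 \<le> S" "S\<^sup>2 = (1 - (c \<bullet> v)\<^sup>2) * (1 - (v \<bullet> b)\<^sup>2)"
    using sq by (simp_all add: S_def power_mult_distrib)
  note \<phi> = dihedral_angle[OF abc(3-5,2), folded \<phi>_def S_def]
  note bound = det_le_star_bound[OF lt1 S \<phi> r(2,3,4,5,1)]
  show "half_angle F v < pi / 2" using \<phi>(2) by (simp add: half)
  show "\<bar>half_area F - half_angle F v\<bar> < half_angle F v"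
    using bound(1) r(2) unfolding half by linarith
  have "convex hull (insert 0 F) = convex hull {0, v, b, c}"
    unfolding abc(1) by (rule hull_insert[symmetric])
  then show "measure lebesgue (convex hull (insert 0 F))
      \<le> 2 * star_bound (half_angle F v) (half_area F - half_angle F v) / 6"
    using content_tetrahedron[of v b c] abc(2) bound(2) by (simp add: half)
qed

lemma measure_trivalent_star:
  assumes v: "v \<in> vertices P" and card: "card (facets_at P v) = 3"
  shows "(\<Sum>F\<in>facets_at P v. measure lebesgue (convex hull (insert 0 F)))
    \<le> sqrt 3 / 4 * (1 - 1 / 3 * (tan ((pi - sum half_area (facets_at P v)) / 3))\<^sup>2)"
proof -
  have sub: "F \<in> facets" "v \<in> F" if "F \<in> facets_at P v" for F
    using that by (auto simp: facets_at_def facets_def)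
  note star = measure_facet_pyramid_star[OF sub(1) v sub(2)]
  have angles: "(\<Sum>F\<in>facets_at P v. half_angle F v) = pi"
    unfolding half_angle_def sum_distrib_left[symmetric] sum_facet_wedge[OF v] by simp
  have "(\<Sum>F\<in>facets_at P v. measure lebesgue (convex hull (insert 0 F)))
      \<le> (\<Sum>F\<in>facets_at P v. 2 * star_bound (half_angle F v) (half_area F - half_angle F v) / 6)"
    using star(3) by (intro sum_mono)
  also have "\<dots> = (\<Sum>F\<in>facets_at P v. 2 * star_bound (half_angle F v) (half_area F - half_angle F v)) / 6"
    by (rule sum_divide_distrib[symmetric])
  also have "(\<Sum>F\<in>facets_at P v. 2 * star_bound (half_angle F v) (half_area F - half_angle F v))
      \<le> 3 * sqrt 3 / 2 * (1 - 1 / 3 * (tan ((\<Sum>F\<in>facets_at P v. half_area F - half_angle F v) / 3))\<^sup>2)"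
    using star(1,2) angles by (intro star_bound_jensen[OF card])
  \<comment> \<open>The half angles add up to \<open>pi\<close>; the sign that appears here is lost
    when the tangent is squared.\<close>
  also have "(\<Sum>F\<in>facets_at P v. half_area F - half_angle F v) / 3
      = - ((pi - sum half_area (facets_at P v)) / 3)"
    unfolding sum_subtractf angles by (simp only: minus_divide_left minus_diff_eq)
  finally show ?thesis by (simp only: tan_minus power2_minus) simp
qed

lemma measure_other_facets:
  assumes A: "A \<subseteq> facets" "A \<noteq> {}"
  shows "(\<Sum>F\<in>A. measure lebesgue (convex hull (insert 0 F)))
    \<le> real (card A) / 4 * facet_bound ((real (card A) * pi - sum half_area A) / (3 * real (card A)))"
proof -
  have "finite A" using A finite_facets finite_subset by blast
  have "(\<Sum>F\<in>A. measure lebesgue (convex hull (insert 0 F)))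
      \<le> (\<Sum>F\<in>A. facet_bound ((pi - half_area F) / 3) / 4)"
    using measure_facet_pyramid A by (intro sum_mono) blast
  also have "\<dots> = (\<Sum>F\<in>A. facet_bound ((pi - half_area F) / 3)) / 4"
    by (rule sum_divide_distrib[symmetric])
  also have "(\<Sum>F\<in>A. facet_bound ((pi - half_area F) / 3))
      \<le> real (card A) * facet_bound ((\<Sum>F\<in>A. (pi - half_area F) / 3) / real (card A))"
  proof (rule facet_bound_jensen[OF \<open>finite A\<close> A(2)])
    fix F assume "F \<in> A"
    then have "0 < half_area F" "half_area F < pi" using half_area_bounds A(1) by blast+
    then show "0 < (pi - half_area F) / 3 \<and> (pi - half_area F) / 3 < pi / 2" by simp
  qed
  also have "(\<Sum>F\<in>A. (pi - half_area F) / 3) / real (card A)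
      = (real (card A) * pi - sum half_area A) / (3 * real (card A))"
    by (simp add: sum_divide_distrib[symmetric] sum_subtractf)
  finally show ?thesis by simp
qed

end

theorem lemma3p10:
  fixes N :: nat
    and P :: "(real ^ 3) set"
    and v0 :: "real ^ 3"
    and F1 F2 F3 :: "(real ^ 3) set"
    and \<alpha> :: real
  assumes "N \<ge> 5"
    and "simplicial_3_polytope P"
    and "card (vertices P) = N"
    and "vertices P \<subseteq> sphere 0 1"
    and "0 \<in> interior P"
    and "v0 \<in> vertices P"
    and "vertex_degree P v0 = 3"
    and "distinct [F1, F2, F3]"
    and "facets_at P v0 = {F1, F2, F3}"
    and "\<alpha> = spherical_area (radial_projection ` F1)
           + spherical_area (radial_projection ` F2)
           + spherical_area (radial_projection ` F3)"
  shows "0 < \<alpha> \<and> \<alpha> < 4 * pi \<and>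
    measure lebesgue P \<le>
      sqrt 3 / 4 * (1 - 1 / 3 * (tan ((2 * pi - \<alpha>) / 6))\<^sup>2)
      + (2 * real N - 7) / 4
        * tan (((4 * real N - 18) * pi + \<alpha>) / (12 * real N - 42))
        * (1 - 1 / 3 * (tan (((4 * real N - 18) * pi + \<alpha>) / (12 * real N - 42)))\<^sup>2)"
proof -
  interpret inscribed_simplicial_polytope P
    using assms by unfold_locales
  define A where "A = facets - facets_at P v0"
  have star: "facets_at P v0 \<subseteq> facets" by (auto simp: facets_at_def facets_def)
  have fin: "finite (facets_at P v0)" using star finite_facets finite_subset by blast
  have card3: "card (facets_at P v0) = 3" using assms(8,9) by simp
  have split: "sum f facets = sum f (facets_at P v0) + sum f A" for f :: "(real^3) set \<Rightarrow> real"
    unfolding A_def using sum.subset_diff[OF star finite_facets, of f] by simp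
  have "finite (vertices P)" using assms(1,3) by (intro card_ge_0_finite) simp
  then have "real (card facets) = 2 * real N - 4" using card_facets assms(3) by simp
  \<comment> \<open>The facets outside the star number \<open>2 N - 4 - 3\<close>. This is positive,
    and their positive total area is what keeps \<open>\<alpha>\<close> below
    \<open>4 \<pi>\<close>.\<close>
  then have cardA: "real (card A) = 2 * real N - 7"
    using split[of "\<lambda>_. 1"] card3 by simp
  then have A: "A \<noteq> {}" "A \<subseteq> facets"
    using assms(1) by (fastforce, simp add: A_def)
  have "\<alpha> = (\<Sum>F\<in>{F1, F2, F3}. spherical_area (radial_projection ` F))"
    using assms(8,10) by simp
  also have "\<dots> = (\<Sum>F\<in>facets_at P v0. 2 * half_area F)"
    using star facet_area assms(9) by (intro sum.cong) auto
  finally have \<alpha>: "sum half_area (facets_at P v0) = \<alpha> / 2"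
    by (simp add: sum_distrib_left[symmetric])
  then have rest: "sum half_area A = 2 * pi - \<alpha> / 2"
    using split[of half_area] sum_half_area by simp
  have "0 < sum half_area (facets_at P v0)"
    using fin card3 star half_area_bounds by (intro sum_pos) auto
  then have pos: "0 < \<alpha>" using \<alpha> by simp
  have "0 < sum half_area A"
    using A finite_facets half_area_bounds by (intro sum_pos) (auto intro: finite_subset)
  then have less: "\<alpha> < 4 * pi" using rest by simp
  have "(\<Sum>F\<in>facets_at P v0. measure lebesgue (convex hull (insert 0 F)))
      \<le> sqrt 3 / 4 * (1 - 1 / 3 * (tan ((2 * pi - \<alpha>) / 6))\<^sup>2)"
  proof -
    have eq: "(pi - \<alpha> / 2) / 3 = (2 * pi - \<alpha>) / 6" by (simp add: field_simps)
    show ?thesis using measure_trivalent_star[OF assms(6) card3] unfolding \<alpha> eq .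
  qed
  moreover have "(\<Sum>F\<in>A. measure lebesgue (convex hull (insert 0 F)))
      \<le> (2 * real N - 7) / 4 * facet_bound (((4 * real N - 18) * pi + \<alpha>) / (12 * real N - 42))"
  proof -
    \<comment> \<open>Doubling numerator and denominator turns the mean over the remaining facets
      into the form of the statement.\<close>
    have "((2 * real N - 7) * pi - (2 * pi - \<alpha> / 2)) / (3 * (2 * real N - 7))
        = (2 * ((2 * real N - 7) * pi - (2 * pi - \<alpha> / 2))) / (2 * (3 * (2 * real N - 7)))"
      by (rule mult_divide_mult_cancel_left[symmetric]) simp
    also have "\<dots> = ((4 * real N - 18) * pi + \<alpha>) / (12 * real N - 42)"
      by (rule arg_cong2[of _ _ _ _ "(/)"]) (simp_all add: algebra_simps)
    finally show ?thesis using measure_other_facets[OF A(2,1)] unfolding cardA rest by simp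
  qed
  ultimately have "measure lebesgue P \<le> sqrt 3 / 4 * (1 - 1 / 3 * (tan ((2 * pi - \<alpha>) / 6))\<^sup>2)
      + (2 * real N - 7) / 4 * facet_bound (((4 * real N - 18) * pi + \<alpha>) / (12 * real N - 42))"
    using measure_le_sum unfolding split by linarith
  then show ?thesis
    using pos less unfolding facet_bound_def by (simp add: mult.assoc)
qed

end
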